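(* Let $A$ be a principal ideal domain, $p\in A$ a prime, $K_p$ the $p$-adic completion of the fraction field of $A$, $\mathcal{O}_p$ its valuation ring. Let $\sigma\in\mathbb{N}$ and let $g,f\in\mathcal{O}_p[x]$ be two monic separable polynomials of degree $d$ such that $g\equiv f\bmod p^\sigma$. (1) If $\sigma>2\delta^*(f)/d$, then $g$ is irreducible if and only if $f$ is irreducible. (2) If $\sigma>\delta^*(f)$, then any OM-factorisation of $g$ is an OM-factorisation of $f$.
   Context: $v_p$ denotes the $p$-adic valuation, extended to a fixed algebraic closure $\overline{K}_p$. Okutsu frame: for $F\in\mathcal{O}_p[x]$ monic irreducible of degree $n$ with root $\alpha$, a sequence $[\phi_1,\ldots,\phi_{r+1}]$ of monic $\phi_i\in\mathcal{O}_p[x]$ of degrees $m_i$ with $m_1\mid m_2\mid\cdots\mid m_{r+1}$, $1\le m_1<\cdots<m_{r+1}=n$, and such that for every $i$ and every monic $h\in\mathcal{O}_p[x]$ with $\deg h<m_{i+1}$ one has $\frac{v_p(h(\alpha))}{\deg h}\le\frac{v_p(\phi_i(\alpha))}{m_i}<\frac{v_p(\phi_{i+1}(\alpha))}{m_{i+1}}$; $\phi_{r+1}$ is its approximant. Okutsu bound: $\delta_0(F):=\deg(F)\max\{v_p(h(\alpha))/\deg h:\ h\in\mathcal{O}_p[x]\text{ monic},\ \deg h<\deg F\}$. If $f=\prod_{\mathfrak{p}}F_\mathfrak{p}$ is the factorisation of $f$ into monic irreducibles in $\mathcal{O}_p[x]$ (indexed by $\mathfrak{p}$), $d_\mathfrak{p}=\deg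 F_\mathfrak{p}$, set $\delta^*(f):=\frac12\sum_{\mathfrak{p}}d_\mathfrak{p}\delta_0(F_\mathfrak{p})+\sum_{\mathfrak{p}\ne\mathfrak{q}}v_p(\mathrm{Res}(F_\mathfrak{p},F_\mathfrak{q}))$. An OM-factorisation of $f$ is a family, indexed by the irreducible factors, of Okutsu frames $\mathcal{F}_\mathfrak{p}$ of $F_\mathfrak{p}$ whose approximants $\phi_\mathfrak{p}$ satisfy $v_p(\phi_\mathfrak{p}(\theta_\mathfrak{p}))>v_p(\phi_\mathfrak{p}(\theta_\mathfrak{q}))$ for all $\mathfrak{p}\ne\mathfrak{q}$, where $\theta_\mathfrak{p}$ is a root of $F_\mathfrak{p}$. *)

theory Defs
  imports
    "HOL-Library.Extended_Real"
    "HOL-Computational_Algebra.Fraction_Field"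
    "HOL-Algebra.Ring_Divisibility"
    "HOL-Algebra.Algebraic_Closure_Type"
    "Subresultants.Resultant_Prelim"
begin

section \<open>The p-adic completion\<close>

definition is_valuation :: "('k::field \<Rightarrow> ereal) \<Rightarrow> bool" where
  "is_valuation v \<longleftrightarrow>
     (\<forall>x. v x \<noteq> -\<infinity>) \<and>
     (\<forall>x. v x = \<infinity> \<longleftrightarrow> x = 0) \<and>
     (\<forall>x y. v (x * y) = v x + v y) \<and>
     (\<forall>x y. min (v x) (v y) \<le> v (x + y))"

text \<open>For a prime element \<open>p\<close> of a principal ideal domain and \<open>a \<noteq> 0\<close>, the set below is finite
  and contains 0.\<close>

definition padic_order :: "'a::idom \<Rightarrow> 'a \<Rightarrow> ereal" where
  "padic_order p a = (if a = 0 then \<infinity> else ereal (real (Max {n. p ^ n dvd a})))"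

text \<open>\<open>padic_completion p j v\<close>: the field \<open>'k\<close>, with valuation \<open>v\<close> and embedding \<open>j\<close> of the
  fraction field of \<open>'a\<close>, is the completion of that fraction field for the valuation defined by
  \<open>p\<close>, i.e. \<open>v\<close> extends this valuation, the image of \<open>j\<close> is dense and Cauchy sequences converge.
  This determines \<open>('k, j, v)\<close> up to unique isomorphism. The values of \<open>v\<close> on the image of \<open>j\<close>
  are determined by those on \<open>'a\<close>, since \<open>v\<close> is multiplicative.\<close>

definition padic_completion ::
    "'a::idom \<Rightarrow> ('a fract \<Rightarrow> 'k::field) \<Rightarrow> ('k \<Rightarrow> ereal) \<Rightarrow> bool" where
  "padic_completion p j v \<longleftrightarrow>
     j 1 = 1 \<and> (\<forall>x y. j (x + y) = j x + j y) \<and> (\<forall>x y. j (x * y) = j x * j y) \<and>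
     is_valuation v \<and>
     (\<forall>a. v (j (Fract a 1)) = padic_order p a) \<and>
     (\<forall>x. \<forall>N::nat. \<exists>y. ereal (real N) \<le> v (x - j y)) \<and>
     (\<forall>s :: nat \<Rightarrow> 'k.
        (\<forall>N::nat. \<exists>M. \<forall>m\<ge>M. \<forall>n\<ge>M. ereal (real N) \<le> v (s m - s n)) \<longrightarrow>
        (\<exists>L. \<forall>N::nat. \<exists>M. \<forall>n\<ge>M. ereal (real N) \<le> v (s n - L)))"

definition int_polys :: "('k::field \<Rightarrow> ereal) \<Rightarrow> 'k poly set" where
  "int_polys v = {f. \<forall>i. 0 \<le> v (coeff f i)}"

text \<open>The polynomial ring over the valuation ring of \<open>v\<close>, for use with the carrier-based notions of
  divisibility and irreducibility.\<close>

definition int_poly_ring :: "('k::field \<Rightarrow> ereal) \<Rightarrow> 'k poly ring" where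
  "int_poly_ring v = (ring_of_type_algebra :: 'k poly ring)\<lparr>carrier := int_polys v\<rparr>"

definition monic_irreducibles :: "('k::field \<Rightarrow> ereal) \<Rightarrow> 'k poly set" where
  "monic_irreducibles v =
     {F \<in> int_polys v. lead_coeff F = 1 \<and> ring_irreducible\<^bsub>int_poly_ring v\<^esub> F}"

text \<open>For monic separable \<open>f\<close> these factors occur with multiplicity one, so \<open>f\<close> is the product
  of the elements of this set.\<close>

definition irreducible_factors :: "('k::field \<Rightarrow> ereal) \<Rightarrow> 'k poly \<Rightarrow> 'k poly set" where
  "irreducible_factors v f = {F \<in> monic_irreducibles v. F divides\<^bsub>int_poly_ring v\<^esub> f}"

definition separable_poly :: "'k::field poly \<Rightarrow> bool" where
  "separable_poly f \<longleftrightarrow> rsquarefree (map_poly to_ac f)"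


section \<open>Okutsu frames and the Okutsu bound\<close>

text \<open>Throughout, \<open>v\<close> is the valuation of the base field, \<open>w\<close> its extension to the algebraic
  closure, \<open>\<alpha>\<close> a root of \<open>F\<close>, and \<open>\<theta>\<close> assigns a root to each monic irreducible polynomial.\<close>

definition val_at :: "('k::field alg_closure \<Rightarrow> ereal) \<Rightarrow> 'k poly \<Rightarrow> 'k alg_closure \<Rightarrow> ereal" where
  "val_at w h \<alpha> = w (poly (map_poly to_ac h) \<alpha>)"

definition slope :: "('k::field alg_closure \<Rightarrow> ereal) \<Rightarrow> 'k poly \<Rightarrow> 'k alg_closure \<Rightarrow> ereal" where
  "slope w h \<alpha> = val_at w h \<alpha> / ereal (real (degree h))"

text \<open>The list \<open>\<phi>s\<close> is zero-based: \<open>\<phi>s ! i\<close> is the member of index \<open>i + 1\<close> of the sequence. The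
  polynomials \<open>h\<close> are nonconstant, as their slope involves division by the degree.\<close>

definition okutsu_frame ::
    "('k::field \<Rightarrow> ereal) \<Rightarrow> ('k alg_closure \<Rightarrow> ereal) \<Rightarrow> 'k poly \<Rightarrow> 'k alg_closure \<Rightarrow> 'k poly list \<Rightarrow> bool"
  where
  "okutsu_frame v w F \<alpha> \<phi>s \<longleftrightarrow>
     \<phi>s \<noteq> [] \<and>
     (\<forall>\<phi>\<in>set \<phi>s. \<phi> \<in> int_polys v \<and> lead_coeff \<phi> = 1) \<and>
     1 \<le> degree (hd \<phi>s) \<and> degree (last \<phi>s) = degree F \<and>
     (\<forall>i. Suc i < length \<phi>s \<longrightarrow>
        degree (\<phi>s ! i) dvd degree (\<phi>s ! Suc i) \<and>
        degree (\<phi>s ! i) < degree (\<phi>s ! Suc i) \<and>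
        (\<forall>h\<in>int_polys v. lead_coeff h = 1 \<and> 0 < degree h \<and> degree h < degree (\<phi>s ! Suc i) \<longrightarrow>
           slope w h \<alpha> \<le> slope w (\<phi>s ! i) \<alpha> \<and>
           slope w (\<phi>s ! i) \<alpha> < slope w (\<phi>s ! Suc i) \<alpha>))"

text \<open>The maximum of slopes is rendered as a supremum in the extended reals; it is attained when
  \<open>\<alpha>\<close> is a root of an irreducible \<open>F\<close> over a complete discretely valued field. For linear \<open>F\<close> there
  is no admissible \<open>h\<close>, and the bound is 0 by convention.\<close>

definition okutsu_bound ::
    "('k::field \<Rightarrow> ereal) \<Rightarrow> ('k alg_closure \<Rightarrow> ereal) \<Rightarrow> 'k poly \<Rightarrow> 'k alg_closure \<Rightarrow> ereal" where
  "okutsu_bound v w F \<alpha> =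
     (if degree F \<le> 1 then 0
      else ereal (real (degree F)) *
        (SUP h \<in> {h \<in> int_polys v. lead_coeff h = 1 \<and> 0 < degree h \<and> degree h < degree F}.
           slope w h \<alpha>))"

text \<open>The second sum ranges over ordered pairs, so each unordered pair of distinct factors counts
  twice.\<close>

definition delta_star ::
    "('k::field \<Rightarrow> ereal) \<Rightarrow> ('k alg_closure \<Rightarrow> ereal) \<Rightarrow> ('k poly \<Rightarrow> 'k alg_closure) \<Rightarrow> 'k poly \<Rightarrow> ereal"
  where
  "delta_star v w \<theta> f =
     1 / 2 * (\<Sum>F\<in>irreducible_factors v f. ereal (real (degree F)) * okutsu_bound v w F (\<theta> F)) +
     (\<Sum>(F, G)\<in>{(F, G). F \<in> irreducible_factors v f \<and> G \<in> irreducible_factors v f \<and> F \<noteq> G}.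
        v (resultant F G))"

text \<open>A family \<open>(\<Phi> i)\<close>, \<open>i \<in> I\<close>, of sequences is an OM-factorisation of \<open>f\<close> if \<open>I\<close> indexes the
  irreducible factors of \<open>f\<close> in such a way that the conditions below hold.\<close>

definition om_factorisation ::
    "('k::field \<Rightarrow> ereal) \<Rightarrow> ('k alg_closure \<Rightarrow> ereal) \<Rightarrow> ('k poly \<Rightarrow> 'k alg_closure) \<Rightarrow> 'k poly \<Rightarrow>
     'i set \<Rightarrow> ('i \<Rightarrow> 'k poly list) \<Rightarrow> bool" where
  "om_factorisation v w \<theta> f I \<Phi> \<longleftrightarrow>
     (\<exists>F. bij_betw F I (irreducible_factors v f) \<and>
          (\<forall>i\<in>I. okutsu_frame v w (F i) (\<theta> (F i)) (\<Phi> i)) \<and>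
          (\<forall>i\<in>I. \<forall>k\<in>I. i \<noteq> k \<longrightarrow>
             val_at w (last (\<Phi> i)) (\<theta> (F k)) < val_at w (last (\<Phi> i)) (\<theta> (F i))))"

end

theory Submission
  imports Defs "Subresultants.Subresultant"
begin

text \<open>
  Completeness makes \<open>w (h x)\<close> the same for all roots \<open>x\<close> of an irreducible \<open>F\<close>, which gives
  the reciprocity \<open>deg F \<cdot> w (G \<alpha>) = deg G \<cdot> w (F \<beta>) = v (Res F G)\<close> for roots \<open>\<alpha>\<close> of \<open>F\<close> and
  \<open>\<beta>\<close> of \<open>G\<close>. Applied to minimal polynomials, it turns the Okutsu bound into a lower bound for the
  degree: if \<open>w (F y) > \<delta>\<^sub>0 F\<close>, then \<open>y\<close> has degree at least \<open>deg F\<close>.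

  If \<open>f\<close> is irreducible, a root \<open>y\<close> of \<open>g\<close> satisfies \<open>w (f y) \<ge> \<sigma> > \<delta>\<^sub>0 f\<close>, so its minimal
  polynomial is \<open>g\<close>. If \<open>g\<close> is irreducible, a root of \<open>g\<close> is so close to all factors of \<open>f\<close> that
  \<open>v (Res F G) \<ge> deg F \<cdot> deg G \<cdot> \<sigma> / d\<close> for any two of them; if there were at least two factors,
  summation would give \<open>2 \<delta>\<^sup>* f \<ge> d \<sigma>\<close>.

  For the second part, put \<open>T F = (\<Sum>G\<noteq>F. w (G \<theta>\<^sub>F))\<close>. Every factor \<open>F\<close> of \<open>f\<close> has a unique partner
  \<open>H\<close> among the factors of \<open>g\<close> with \<open>w (F \<theta>\<^sub>H) + T F \<ge> \<sigma>\<close>; the degree bound and a degree count make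
  this a degree preserving bijection. A polynomial \<open>h\<close> takes different values at roots of \<open>F\<close> and
  \<open>H\<close> only if it has a root close to both, hence an irreducible factor of degree at least
  \<open>deg F\<close>. This does not happen for \<open>deg h < deg F\<close>, and for the last member of a frame
  the values are then controlled by \<open>\<sigma> > \<delta>\<^sup>* f\<close>.
\<close>

section \<open>Valuations\<close>

locale valuation =
  fixes v :: "'k::field \<Rightarrow> ereal"
  assumes is_valuation: "is_valuation v"
begin

lemma val_0 [simp]: "v 0 = \<infinity>"
  and val_eq_infinity_iff [simp]: "v x = \<infinity> \<longleftrightarrow> x = 0"
  and val_neq_minus_infinity [simp]: "v x \<noteq> -\<infinity>"
  and val_mult: "v (x * y) = v x + v y"
  and val_add_ge: "min (v x) (v y) \<le> v (x + y)"
  using is_valuation unfolding is_valuation_def by auto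

lemma val_1 [simp]: "v 1 = 0"
  using val_mult[of 1 1] val_eq_infinity_iff[of 1] val_neq_minus_infinity[of 1]
  by (cases "v 1") auto

lemma val_uminus [simp]: "v (- x) = v x"
proof -
  have "v (-1) = 0"
    using val_mult[of "-1" "-1"] val_neq_minus_infinity[of "-1"] by (cases "v (-1)") auto
  then show ?thesis
    using val_mult[of "-1" x] by simp
qed

lemma val_minus_commute: "v (x - y) = v (y - x)"
  using val_uminus[of "x - y"] by simp

lemma val_add_geI: "r \<le> v x \<Longrightarrow> r \<le> v y \<Longrightarrow> r \<le> v (x + y)"
  using val_add_ge[of x y] by (meson min.boundedI order_trans)

lemma val_diff_geI: "r \<le> v x \<Longrightarrow> r \<le> v y \<Longrightarrow> r \<le> v (x - y)"
  using val_add_geI[of r x "- y"] by simp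

lemma val_add_eq:
  assumes "v x < v y"
  shows "v (x + y) = v x"
proof (rule antisym)
  show "v x \<le> v (x + y)"
    using assms by (intro val_add_geI) auto
  show "v (x + y) \<le> v x"
  proof (rule ccontr)
    assume "\<not> v (x + y) \<le> v x"
    then have "v x < min (v (x + y)) (v y)"
      using assms by auto
    also have "\<dots> \<le> v ((x + y) - y)"
      by (rule val_diff_geI) auto
    finally show False
      by simp
  qed
qed

lemma val_power: "v (x ^ n) = ereal (real n) * v x"
proof (induction n)
  case (Suc n)
  then show ?case
    using val_neq_minus_infinity[of x]
    by (cases "v x"; cases n) (auto simp: val_mult algebra_simps)
qed (simp add: zero_ereal_def[symmetric])

lemma val_sum_geI: "(\<And>i. i \<in> A \<Longrightarrow> r \<le> v (f i)) \<Longrightarrow> r \<le> v (sum f A)"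
  by (induction A rule: infinite_finite_induct) (auto intro: val_add_geI)

lemma val_prod_mset: "v (\<Prod>x\<in>#A. f x) = (\<Sum>x\<in>#A. v (f x))"
  by (induction A) (auto simp: val_mult)

lemma close_trans: "r \<le> v (a - b) \<Longrightarrow> r \<le> v (b - c) \<Longrightarrow> r \<le> v (a - c)"
  using val_add_geI[of r "a - b" "b - c"] by simp

lemma val_diff_eq_of_closer:
  assumes "v (a - c) < v (a - b)"
  shows "v (b - c) = v (a - c)"
  using val_add_eq[of "a - c" "b - a"] assms by (simp add: val_minus_commute[of b a])

text \<open>Every point of an ultrametric ball is a centre of it, so truncated distances cannot tell
  \<open>a\<close> and \<open>b\<close> apart.\<close>

lemma min_val_diff_cong:
  assumes "r \<le> v (a - b)"
  shows "min r (v (a - c)) = min r (v (b - c))"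
proof (rule antisym)
  show "min r (v (a - c)) \<le> min r (v (b - c))"
    using assms close_trans[of "min r (v (a - c))" b a c]
    by (simp add: val_minus_commute[of b a] min.coboundedI1)
  show "min r (v (b - c)) \<le> min r (v (a - c))"
    using assms close_trans[of "min r (v (b - c))" a b c]
    by (simp add: min.coboundedI1)
qed

section \<open>Polynomials with integral coefficients\<close>

lemma zero_in_int_polys [simp]: "0 \<in> int_polys v"
  and one_in_int_polys [simp]: "1 \<in> int_polys v"
  by (auto simp: int_polys_def coeff_1)

lemma const_in_int_polys_iff [simp]: "[:c:] \<in> int_polys v \<longleftrightarrow> 0 \<le> v c"
  by (auto simp: int_polys_def coeff_pCons split: nat.splits)

lemma pCons_in_int_polys_iff [simp]:
  "pCons c h \<in> int_polys v \<longleftrightarrow> 0 \<le> v c \<and> h \<in> int_polys v"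
  unfolding int_polys_def mem_Collect_eq coeff_pCons
  by (auto split: nat.splits dest: spec[of _ "Suc _"] spec[of _ 0])

lemma mult_in_int_polys: "f \<in> int_polys v \<Longrightarrow> g \<in> int_polys v \<Longrightarrow> f * g \<in> int_polys v"
  by (auto simp: int_polys_def coeff_mult val_mult intro!: val_sum_geI)

lemma prod_mset_in_int_polys:
  "(\<And>x. x \<in># A \<Longrightarrow> f x \<in> int_polys v) \<Longrightarrow> (\<Prod>x\<in>#A. f x) \<in> int_polys v"
  by (induction A) (auto intro: mult_in_int_polys)

lemma val_poly_nonneg: "h \<in> int_polys v \<Longrightarrow> 0 \<le> v x \<Longrightarrow> 0 \<le> v (poly h x)"
  by (induction h) (auto simp: val_mult intro!: val_add_geI)

text \<open>With \<open>\<not> 0 \<le> v x\<close> the leading term of a monic integral polynomial dominates strictly.\<close>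

lemma val_root_nonneg:
  assumes "f \<in> int_polys v" "lead_coeff f = 1" "poly f x = 0"
  shows "0 \<le> v x"
proof (rule ccontr)
  assume neg: "\<not> 0 \<le> v x"
  then obtain r where r: "v x = ereal r" "r < 0"
    using val_neq_minus_infinity[of x] by (cases "v x") auto
  define n where "n = degree f"
  have n: "n > 0"
    using assms by (intro Nat.gr0I) (auto simp: n_def elim!: degree_eq_zeroE)
  have "poly f x = (\<Sum>i<n. coeff f i * x ^ i) + x ^ n"
    using assms(2) by (simp add: poly_altdef n_def lessThan_Suc_atMost[symmetric])
  then have "x ^ n = - (\<Sum>i<n. coeff f i * x ^ i)"
    using assms(3) by (metis add.commute add_eq_0_iff)
  then have "v (x ^ n) = v (\<Sum>i<n. coeff f i * x ^ i)"
    by simp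
  moreover have "ereal (real (n - 1) * r) \<le> v (\<Sum>i<n. coeff f i * x ^ i)"
  proof (rule val_sum_geI)
    fix i assume "i \<in> {..<n}"
    then have "real i \<le> real (n - 1)"
      by auto
    then have "ereal (real (n - 1) * r) \<le> ereal (real i * r)"
      using r(2) by (simp add: mult_right_mono_neg)
    also have "\<dots> \<le> v (coeff f i) + v (x ^ i)"
      using assms(1) by (simp add: int_polys_def val_power r add_increasing)
    finally show "ereal (real (n - 1) * r) \<le> v (coeff f i * x ^ i)"
      by (simp add: val_mult)
  qed
  moreover have "v (x ^ n) < ereal (real (n - 1) * r)"
    using n mult_strict_right_mono_neg[OF _ r(2), of "real (n - 1)" "real n"]
    by (simp add: val_power r del: of_nat_diff)
  ultimately show False
    by auto
qed

end

section \<open>Polynomials with given roots\<close>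

text \<open>Gauss's lemma for products of linear polynomials: the least coefficient valuation is
  additive over the factors. An index attaining it is tracked through the multiplication by one more
  factor.\<close>

lemma (in valuation) val_coeff_prod_linear:
  fixes t :: 'k and a :: "'b \<Rightarrow> 'k"
  defines "q A \<equiv> (\<Prod>x\<in>#A. [:a x, t:])"
  defines "s A \<equiv> (\<Sum>x\<in>#A. min (v (a x)) (v t))"
  shows "(\<forall>i. s A \<le> v (coeff (q A) i)) \<and> (\<exists>i. v (coeff (q A) i) = s A)"
proof (induction A)
  case empty
  then show ?case
    by (auto simp: q_def s_def coeff_1 intro!: exI[of _ 0])
next
  case (add x A)
  define m where "m = min (v (a x)) (v t)"
  have s: "s (add_mset x A) = m + s A"
    by (simp add: s_def m_def)
  define Q where "Q = q A"
  have coeff: "coeff (q (add_mset x A)) i =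
      a x * coeff Q i + (case i of 0 \<Rightarrow> 0 | Suc k \<Rightarrow> t * coeff Q k)" for i
    by (simp add: q_def Q_def coeff_pCons split: nat.split)
  have le: "s A \<le> v (coeff Q i)" for i
    using add.IH by (simp add: Q_def)
  have *: "\<forall>i. m + s A \<le> v (coeff (q (add_mset x A)) i)"
    unfolding coeff
    by (auto split: nat.split intro!: val_add_geI add_mono le simp: val_mult m_def)
  obtain i0 where i0: "v (coeff Q i0) = s A"
    using add.IH by (auto simp: Q_def)
  have "\<exists>i. v (coeff (q (add_mset x A)) i) = m + s A"
  proof (cases "m + s A = \<infinity>")
    case True
    then show ?thesis
      using * by (intro exI[of _ 0]) (metis ereal_infty_less_eq(1))
  next
    case fin: False
    then have sfin: "s A \<noteq> \<infinity>" and mfin: "m \<noteq> \<infinity>" "m \<noteq> -\<infinity>" "s A \<noteq> -\<infinity>"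
      using i0 val_neq_minus_infinity[of "coeff Q i0"] by (auto simp: m_def min_def)
    show ?thesis
    proof (cases "v t < v (a x)")
      case True
      then have "v (t * coeff Q i0) < v (a x * coeff Q (Suc i0))"
        using le[of "Suc i0"] sfin mfin i0 unfolding val_mult m_def
        by (cases "v t"; cases "v (a x)"; cases "s A"; cases "v (coeff Q (Suc i0))") auto
      then have "v (t * coeff Q i0 + a x * coeff Q (Suc i0)) = v (t * coeff Q i0)"
        by (rule val_add_eq)
      then show ?thesis
        using True i0 by (intro exI[of _ "Suc i0"]) (simp add: coeff val_mult m_def add.commute)
    next
      case False
      \<comment> \<open>Taking the least index that attains the minimum makes the previous
        coefficient strictly larger, so its product with \<open>t\<close> cannot cancel
        \<open>a x * coeff Q i\<close>, even if \<open>t\<close> and \<open>a x\<close> have equal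
        valuation.\<close>
      define i where "i = (LEAST i. v (coeff Q i) = s A)"
      have i: "v (coeff Q i) = s A"
        unfolding i_def using i0 by (rule LeastI)
      have less: "s A < v (coeff Q k)" if "k < i" for k
        using le[of k] not_less_Least[of k "\<lambda>i. v (coeff Q i) = s A"] that
        by (auto simp: i_def less_le)
      have "v (a x * coeff Q i) < v (case i of 0 \<Rightarrow> 0 | Suc k \<Rightarrow> t * coeff Q k)"
      proof (cases i)
        case 0
        then show ?thesis
          using i sfin mfin False by (auto simp: val_mult m_def min_def)
      next
        case (Suc k)
        then show ?thesis
          using i sfin mfin False less[of k] unfolding m_def
          by (cases "v t"; cases "v (a x)"; cases "s A"; cases "v (coeff Q k)")
            (auto simp: val_mult)
      qed
      then have "v (coeff (q (add_mset x A)) i) = v (a x * coeff Q i)"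
        unfolding coeff by (rule val_add_eq)
      then show ?thesis
        using False i by (intro exI[of _ i]) (simp add: val_mult m_def min_def not_less)
    qed
  qed
  then show ?case
    using * s by simp
qed

lemma alg_closed_proots:
  fixes p :: "'b::alg_closed_field poly"
  assumes "p \<noteq> 0"
  shows "size (proots p) = degree p"
    and "p = smult (lead_coeff p) (\<Prod>x\<in>#proots p. [:-x, 1:])"
proof -
  obtain A where A: "size A = degree p" "p = smult (lead_coeff p) (\<Prod>x\<in>#A. [:-x, 1:])"
    using alg_closed_imp_factorization[OF assms] by blast
  have "proots (\<Prod>x\<in>#A. [:-x, 1:]) = A"
  proof (induction A)
    case (add x A)
    have "(\<Prod>x\<in>#A. [:-x, 1:]) \<noteq> 0"
      by (auto simp: prod_mset_zero_iff)
    then show ?case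
      using add proots_mult[of "[:-x, 1:]" "\<Prod>x\<in>#A. [:-x, 1:]"] proots_linear_factor[of "-x"]
      by (simp del: mult_pCons_left)
  qed simp
  then have "proots p = A"
    using assms A(2) by (metis leading_coeff_0_iff proots_smult)
  with A show "size (proots p) = degree p"
    and "p = smult (lead_coeff p) (\<Prod>x\<in>#proots p. [:-x, 1:])"
    by auto
qed

lemma poly_prod_mset: "poly (\<Prod>x\<in>#A. f x) y = (\<Prod>x\<in>#A. poly (f x) y)"
  by (induction A) auto

lemma alg_closed_poly_eq_prod:
  fixes p :: "'b::alg_closed_field poly"
  assumes "p \<noteq> 0"
  shows "poly p y = lead_coeff p * (\<Prod>x\<in>#proots p. y - x)"
  by (subst alg_closed_proots(2)[OF assms]) (simp add: poly_prod_mset)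

section \<open>Valuations on the algebraic closure of a complete field\<close>

interpretation to_ac: field_hom "to_ac :: 'k::field \<Rightarrow> 'k alg_closure"
  by unfold_locales auto

interpretation to_ac_poly: map_poly_inj_idom_hom "to_ac :: 'k::field \<Rightarrow> 'k alg_closure"
  by unfold_locales

abbreviation ac_poly :: "'k::field poly \<Rightarrow> 'k alg_closure poly" where
  "ac_poly \<equiv> map_poly to_ac"

definition rts :: "'k::field poly \<Rightarrow> 'k alg_closure multiset" where
  "rts h = proots (ac_poly h)"

lemma size_rts: "h \<noteq> 0 \<Longrightarrow> size (rts h) = degree h"
  by (simp add: rts_def alg_closed_proots(1))

lemma in_rts_iff: "h \<noteq> 0 \<Longrightarrow> x \<in># rts h \<longleftrightarrow> poly (ac_poly h) x = 0"
  by (simp add: rts_def)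

lemma rts_mult: "f \<noteq> 0 \<Longrightarrow> g \<noteq> 0 \<Longrightarrow> rts (f * g) = rts f + rts g"
  by (simp add: rts_def to_ac_poly.hom_mult proots_mult)

lemma monic_nonzero: "lead_coeff f = 1 \<Longrightarrow> f \<noteq> (0 :: 'b::comm_semiring_1 poly)"
  by auto

lemma monic_eqI_dvd:
  fixes f g :: "'k::field poly"
  assumes "f dvd g" "lead_coeff f = 1" "lead_coeff g = 1" "degree g \<le> degree f"
  shows "f = g"
proof -
  obtain c where c: "g = f * c"
    using assms(1) by (elim dvdE)
  then have "c \<noteq> 0" "f \<noteq> 0"
    using assms by auto
  then have "degree c = 0" "lead_coeff c = 1"
    using assms c lead_coeff_mult[of f c] by (auto simp: degree_mult_eq)
  then show ?thesis
    using c by (auto elim!: degree_eq_zeroE)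
qed

text \<open>Completeness is imposed on the base field; that \<open>w\<close> does not distinguish
  conjugate elements is derived from it in \<open>val_conjugate\<close>.\<close>

locale complete_valuation =
  fixes v :: "'k::field \<Rightarrow> ereal" and w :: "'k alg_closure \<Rightarrow> ereal"
  assumes is_valuation_ext: "is_valuation w"
    and ext: "w (to_ac x) = v x"
    and complete: "\<And>s :: nat \<Rightarrow> 'k.
        (\<And>N. \<exists>M. \<forall>m\<ge>M. \<forall>n\<ge>M. ereal (real N) \<le> v (s m - s n)) \<Longrightarrow>
        \<exists>L. \<forall>N. \<exists>M. \<forall>n\<ge>M. ereal (real N) \<le> v (s n - L)"
begin

sublocale valuation w
  by unfold_locales (rule is_valuation_ext)

sublocale base: valuation v
proof
  have "v = w \<circ> to_ac"
    by (auto simp: ext)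
  then show "is_valuation v"
    using is_valuation_ext unfolding is_valuation_def by (simp add: comp_def)
qed

abbreviation val where "val \<equiv> val_at w"

lemma ac_poly_int_polys_iff [simp]: "ac_poly h \<in> int_polys w \<longleftrightarrow> h \<in> int_polys v"
  by (simp add: int_polys_def coeff_map_poly ext)

lemma val_mult_poly: "val (f * g) x = val f x + val g x"
  by (simp add: val_at_def to_ac_poly.hom_mult val_mult)

lemma val_nonneg: "h \<in> int_polys v \<Longrightarrow> 0 \<le> w x \<Longrightarrow> 0 \<le> val h x"
  by (simp add: val_at_def val_poly_nonneg)

lemma val_ge_of_coeffs:
  assumes "\<And>i. r \<le> v (coeff h i)" "0 \<le> w x"
  shows "r \<le> val h x"
  unfolding val_at_def poly_altdef
  using assms by (intro val_sum_geI)
    (auto simp: val_mult coeff_map_poly ext val_power intro!: add_increasing2)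

text \<open>Translates values of polynomials into distances between roots, to which the ultrametric
  arguments below apply.\<close>

lemma val_eq_sum_rts:
  assumes "lead_coeff h = 1"
  shows "val h x = (\<Sum>y\<in>#rts h. w (x - y))"
  using monic_nonzero[OF assms] assms
  by (simp add: val_at_def rts_def alg_closed_poly_eq_prod val_prod_mset)

lemma rts_nonneg:
  assumes "h \<in> int_polys v" "lead_coeff h = 1" "x \<in># rts h"
  shows "0 \<le> w x"
  using monic_nonzero[OF assms(2)] assms val_root_nonneg[of "ac_poly h" x]
  by (simp add: in_rts_iff)

text \<open>Together with \<open>rts_nonneg\<close>, integrality of a monic polynomial becomes
  integrality of its roots and hence passes to monic divisors.\<close>

lemma int_polys_of_rts:
  assumes "lead_coeff h = 1" "\<And>x. x \<in># rts h \<Longrightarrow> 0 \<le> w x"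
  shows "h \<in> int_polys v"
proof -
  have "ac_poly h = (\<Prod>x\<in>#rts h. [:- x, 1:])"
    using alg_closed_proots(2)[of "ac_poly h"] monic_nonzero[OF assms(1)] assms(1)
    by (simp add: rts_def)
  then have "ac_poly h \<in> int_polys w"
    using assms(2) by (auto intro!: prod_mset_in_int_polys)
  then show ?thesis
    by simp
qed

lemma int_polys_of_dvd:
  assumes "h dvd f" "lead_coeff h = 1" "lead_coeff f = 1" "f \<in> int_polys v"
  shows "h \<in> int_polys v"
proof (rule int_polys_of_rts)
  fix x assume "x \<in># rts h"
  then have "x \<in># rts f"
    using assms monic_nonzero[of h] monic_nonzero[of f]
    by (auto simp: in_rts_iff to_ac_poly.hom_mult)
  then show "0 \<le> w x"
    using assms rts_nonneg by blast
qed fact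

subsection \<open>Conjugate roots\<close>

text \<open>On the span of \<open>1, x, \<dots>, x ^ (m - 1)\<close> the valuation \<open>w\<close> is comparable with the minimum of the
  coordinates. In the induction step the span of the first \<open>m\<close> powers is complete, hence its
  distance to \<open>x ^ m\<close> is positive.\<close>

lemma val_coeff_bound:
  assumes x: "0 \<le> w x"
    and minimal: "\<And>h. h \<noteq> 0 \<Longrightarrow> poly (ac_poly h) x = 0 \<Longrightarrow> n \<le> degree h"
    and "m \<le> n"
  shows "\<exists>C\<ge>0. \<forall>h. (\<forall>i\<ge>m. coeff h i = 0) \<longrightarrow> (\<forall>i. val h x \<le> v (coeff h i) + ereal C)"
  using \<open>m \<le> n\<close>
proof (induction m)
  case 0
  then show ?case
    by (intro exI[of _ 0]) auto
next
  case (Suc m)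
  then obtain C where "C \<ge> 0" and
    C: "\<And>h i. \<forall>i\<ge>m. coeff h i = 0 \<Longrightarrow> val h x \<le> v (coeff h i) + ereal C"
    by auto
  have "\<exists>D\<ge>0. \<forall>y. (\<forall>i\<ge>m. coeff y i = 0) \<longrightarrow> val (monom 1 m + y) x \<le> ereal D"
  proof (rule ccontr)
    assume neg: "\<not> ?thesis"
    have "\<exists>y. (\<forall>i\<ge>m. coeff y i = 0) \<and> ereal (real k) < val (monom 1 m + y) x" for k :: nat
    proof (rule ccontr)
      assume "\<not> ?thesis"
      then have "\<forall>y. (\<forall>i\<ge>m. coeff y i = 0) \<longrightarrow> val (monom 1 m + y) x \<le> ereal (real k)"
        by (auto simp: not_less)
      with neg show False
        by (meson of_nat_0_le_iff)
    qed
    then obtain Y where Y0: "\<And>k. \<forall>i\<ge>m. coeff (Y k) i = 0"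
      and Y: "\<And>k. ereal (real k) < val (monom 1 m + Y k) x"
      by metis
    \<comment> \<open>Reading off coefficients from values costs the constant \<open>C\<close>; the
      start index is shifted by its ceiling to make up for this.\<close>
    have cauchy: "ereal (real N) \<le> v (coeff (Y k) i - coeff (Y l) i)"
      if "k \<ge> N + nat \<lceil>C\<rceil>" "l \<ge> N + nat \<lceil>C\<rceil>" for N k l i
    proof -
      have "ereal (real N + C) \<le> ereal (real k)" "ereal (real N + C) \<le> ereal (real l)"
        using that by (simp_all, linarith+)
      then have "ereal (real N + C) \<le> val (monom 1 m + Y k) x"
        "ereal (real N + C) \<le> val (monom 1 m + Y l) x"
        using Y[of k] Y[of l] by (meson less_imp_le order_trans)+
      then have "ereal (real N + C) \<le>
          w (poly (ac_poly (monom 1 m + Y k)) x - poly (ac_poly (monom 1 m + Y l)) x)"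
        unfolding val_at_def by (rule val_diff_geI)
      also have "\<dots> = val (Y k - Y l) x"
        by (simp add: val_at_def to_ac_poly.hom_add to_ac_poly.hom_minus)
      also have "\<dots> \<le> v (coeff (Y k - Y l) i) + ereal C"
        using Y0 by (intro C) auto
      finally show ?thesis
        by (cases "v (coeff (Y k) i - coeff (Y l) i)") auto
    qed
    have "\<exists>L. \<forall>N. \<exists>M. \<forall>k\<ge>M. ereal (real N) \<le> v (coeff (Y k) i - L)" for i
    proof (rule complete[of "\<lambda>k. coeff (Y k) i"])
      show "\<exists>M. \<forall>k\<ge>M. \<forall>l\<ge>M. ereal (real N) \<le> v (coeff (Y k) i - coeff (Y l) i)" for N
        using cauchy by blast
    qed
    then obtain L where L: "\<And>i N. \<exists>M. \<forall>k\<ge>M. ereal (real N) \<le> v (coeff (Y k) i - L i)"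
      by metis
    \<comment> \<open>The coefficientwise limit: \<open>monom 1 m + y\<close> will vanish at
      \<open>x\<close> although its degree \<open>m\<close> is smaller than
      \<open>n\<close>.\<close>
    define y where "y = (\<Sum>i<m. monom (L i) i)"
    have coeff_y: "coeff y i = (if i < m then L i else 0)" for i
      by (auto simp: y_def coeff_sum)
    have large: "ereal (real N) \<le> val (monom 1 m + y) x" for N
    proof -
      obtain M where M: "\<And>i k. k \<ge> M i \<Longrightarrow> ereal (real N) \<le> v (coeff (Y k) i - L i)"
        using L[where N = N] by metis
      define k where "k = Max (insert N (M ` {..<m}))"
      have k: "N \<le> k" "\<And>i. i < m \<Longrightarrow> M i \<le> k"
        by (auto simp: k_def)
      have "ereal (real N) \<le> v (coeff (Y k - y) i)" for i
        using M[of i k] k(2)[of i] Y0[of k] by (cases "i < m") (auto simp: coeff_y)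
      then have "ereal (real N) \<le> val (Y k - y) x"
        using x by (intro val_ge_of_coeffs)
      moreover have "ereal (real N) \<le> val (monom 1 m + Y k) x"
        using Y[of k] k(1) by (meson ereal_less_eq(3) less_imp_le of_nat_le_iff order_trans)
      ultimately have "ereal (real N) \<le>
          w (poly (ac_poly (monom 1 m + Y k)) x - poly (ac_poly (Y k - y)) x)"
        unfolding val_at_def by (intro val_diff_geI)
      then show ?thesis
        by (simp add: val_at_def to_ac_poly.hom_add to_ac_poly.hom_minus)
    qed
    have "val (monom 1 m + y) x = \<infinity>"
    proof (cases "val (monom 1 m + y) x")
      case (real r)
      then show ?thesis
        using large[of "nat \<lceil>r\<rceil> + 1"] by simp linarith
    qed (use large[of 0] in auto)
    moreover have "coeff (monom 1 m + y) m = 1"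
      by (simp add: coeff_y)
    then have "monom 1 m + y \<noteq> 0"
      by (metis coeff_0 zero_neq_one)
    moreover have "degree (monom 1 m + y) \<le> m"
      by (rule degree_le) (auto simp: coeff_y)
    ultimately show False
      using minimal[of "monom 1 m + y"] Suc.prems by (auto simp: val_at_def)
  qed
  then obtain D where "D \<ge> 0" and
    D: "\<And>y. \<forall>i\<ge>m. coeff y i = 0 \<Longrightarrow> val (monom 1 m + y) x \<le> ereal D"
    by auto
  have "val h x \<le> v (coeff h i) + ereal (C + D)" if h: "\<forall>i\<ge>Suc m. coeff h i = 0" for h i
  proof -
    define a where "a = coeff h m"
    define g where "g = h - monom a m"
    have g: "\<forall>i\<ge>m. coeff g i = 0"
      using h by (auto simp: g_def a_def Suc_le_eq)
    have top: "val h x \<le> v a + ereal D"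
    proof (cases "a = 0")
      case False
      have "h = smult a (monom 1 m + smult (inverse a) g)"
        using False by (simp add: g_def smult_add_right smult_monom)
      then have "val h x = v a + val (monom 1 m + smult (inverse a) g) x"
        by (metis val_at_def ext val_mult poly_smult to_ac.map_poly_hom_smult)
      also have "\<dots> \<le> v a + ereal D"
        using g by (intro add_left_mono D) auto
      finally show ?thesis .
    qed simp
    show ?thesis
    proof (cases "i = m")
      case True
      have "val h x \<le> v a + ereal D"
        by (rule top)
      also have "\<dots> \<le> v a + ereal (C + D)"
        using \<open>C \<ge> 0\<close> by (intro add_left_mono) auto
      finally show ?thesis
        using True by (simp add: a_def)
    next
      case False
      have "0 \<le> w (x ^ m)"
        using x by (simp add: val_power)
      moreover have "val h x - ereal D \<le> v a"
        using top by (cases "val h x"; cases "v a") auto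
      ultimately have "val h x - ereal D \<le> w (to_ac a * x ^ m)"
        unfolding val_mult ext by (intro add_increasing2)
      moreover have "val h x - ereal D \<le> val h x"
        using \<open>D \<ge> 0\<close> by (cases "val h x") auto
      ultimately have "val h x - ereal D \<le> w (poly (ac_poly h) x - to_ac a * x ^ m)"
        unfolding val_at_def by (intro val_diff_geI)
      also have "\<dots> = val g x"
        by (simp add: val_at_def g_def to_ac_poly.hom_minus poly_monom map_poly_monom)
      also have "\<dots> \<le> v (coeff g i) + ereal C"
        using g by (intro C) auto
      also have "coeff g i = coeff h i"
        using False by (simp add: g_def)
      finally show ?thesis
        by (cases "val h x"; cases "v (coeff h i)") (auto simp: algebra_simps)
    qed
  qed
  then show ?case
    using \<open>C \<ge> 0\<close> \<open>D \<ge> 0\<close> by (intro exI[of _ "C + D"]) auto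
qed

text \<open>Comparing both sides for all powers of \<open>h\<close> removes the additive constant.\<close>

lemma val_conjugate_le:
  assumes F: "lead_coeff F = 1" "poly (ac_poly F) x = 0" "poly (ac_poly F) y = 0"
    and xy: "0 \<le> w x" "0 \<le> w y"
    and minimal: "\<And>h. h \<noteq> 0 \<Longrightarrow> poly (ac_poly h) x = 0 \<Longrightarrow> degree F \<le> degree h"
  shows "val h x \<le> val h y"
proof -
  obtain C where C: "\<And>h i. \<forall>i\<ge>degree F. coeff h i = 0 \<Longrightarrow> val h x \<le> v (coeff h i) + ereal C"
    using val_coeff_bound[OF xy(1) minimal order_refl] by blast
  have F0: "F \<noteq> 0"
    using F(1) by auto
  have "degree F > 0"
    using F by (intro Nat.gr0I) (auto elim!: degree_eq_zeroE)
  \<comment> \<open>The coefficients mediate: the value at \<open>x\<close> bounds them from below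
    up to \<open>C\<close>, and they bound the value at the integral point \<open>y\<close> from
    below.\<close>
  have *: "val g x \<le> val g y + ereal C" if g: "\<forall>i\<ge>degree F. coeff g i = 0" for g
  proof -
    have "val g x - ereal C \<le> v (coeff g i)" for i
      using C[OF g, of i] by (cases "val g x"; cases "v (coeff g i)") auto
    then have "val g x - ereal C \<le> val g y"
      using xy by (intro val_ge_of_coeffs)
    then show ?thesis
      by (cases "val g x"; cases "val g y") auto
  qed
  have pow: "ereal (real k) * val h x \<le> ereal (real k) * val h y + ereal C" for k
  proof -
    \<comment> \<open>Reduction modulo \<open>F\<close> keeps the values at both roots and brings
      every power of \<open>h\<close> into the range where the same \<open>C\<close> is
      valid.\<close>
    define g where "g = h ^ k mod F"
    have "degree g < degree F"
      unfolding g_def using \<open>degree F > 0\<close> F0 by (metis degree_0 degree_mod_less)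
    have eq: "poly (ac_poly (h ^ k)) z = poly (ac_poly g) z" if "poly (ac_poly F) z = 0" for z
    proof -
      have "ac_poly (h ^ k) = ac_poly (h ^ k div F) * ac_poly F + ac_poly g"
        unfolding g_def by (metis div_mult_mod_eq to_ac_poly.hom_add to_ac_poly.hom_mult)
      then show ?thesis
        using that by simp
    qed
    have "val (h ^ k) x \<le> val (h ^ k) y + ereal C"
      using *[of g] \<open>degree g < degree F\<close> eq[OF F(2)] eq[OF F(3)]
      by (auto simp: val_at_def coeff_eq_0)
    then show ?thesis
      by (simp add: val_at_def to_ac_poly.hom_power poly_power val_power)
  qed
  show ?thesis
  proof (rule ccontr)
    assume neg: "\<not> ?thesis"
    obtain b where b: "val h y = ereal b"
      using neg val_neq_minus_infinity by (cases "val h y") (auto simp: val_at_def)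
    then obtain a where a: "val h x = ereal a"
      using pow[of 1] neg by (cases "val h x") auto
    have "b < a"
      using neg a b by auto
    then obtain k :: nat where "real k * (a - b) > C"
      using reals_Archimedean3[of "a - b"] by auto
    then show False
      using pow[of k] a b by (simp add: algebra_simps)
  qed
qed

end

section \<open>Resultants as products over roots\<close>

text \<open>Poisson's product formula, kept as a separate function until it is shown to follow the
  same Euclidean recursion as the determinantal \<open>resultant\<close>.\<close>

definition root_resultant :: "'b::alg_closed_field poly \<Rightarrow> 'b poly \<Rightarrow> 'b" where
  "root_resultant F G = lead_coeff F ^ degree G * (\<Prod>x\<in>#proots F. poly G x)"

lemma root_resultant_swap:
  fixes F G :: "'b::alg_closed_field poly"
  assumes "F \<noteq> 0" "G \<noteq> 0"
  shows "root_resultant F G = (-1) ^ (degree F * degree G) * root_resultant G F"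
proof -
  have expand: "root_resultant F G = lead_coeff F ^ degree G * lead_coeff G ^ degree F *
      (\<Prod>x\<in>#proots F. \<Prod>y\<in>#proots G. x - y)" if "F \<noteq> 0" "G \<noteq> 0" for F G :: "'b poly"
    using that by (simp add: root_resultant_def alg_closed_poly_eq_prod prod_mset.distrib
        alg_closed_proots(1))
  have "(\<Prod>x\<in>#proots F. \<Prod>y\<in>#proots G. x - y) =
      (\<Prod>x\<in>#proots F. \<Prod>y\<in>#proots G. (-1) * (y - x))"
    by simp
  also have "\<dots> = (-1) ^ (degree F * degree G) * (\<Prod>x\<in>#proots F. \<Prod>y\<in>#proots G. y - x)"
    unfolding prod_mset.distrib
    using assms by (simp add: alg_closed_proots(1) power_mult[symmetric] mult.commute)
  also have "(\<Prod>x\<in>#proots F. \<Prod>y\<in>#proots G. y - x) = (\<Prod>y\<in>#proots G. \<Prod>x\<in>#proots F. y - x)"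
    by (rule prod_mset.swap)
  finally show ?thesis
    using expand[of F G] expand[of G F] assms by (simp add: mult_ac)
qed

lemma root_resultant_add_mult:
  assumes "F + B * G = H" "G \<noteq> 0" "degree H \<le> degree F"
  shows "root_resultant G F = lead_coeff G ^ (degree F - degree H) * root_resultant G H"
proof -
  have "(\<Prod>x\<in>#proots G. poly F x) = (\<Prod>x\<in>#proots G. poly H x)"
    using assms by (auto intro!: arg_cong[of _ _ prod_mset] image_mset_cong)
  then show ?thesis
    using assms(3) by (simp add: root_resultant_def mult.assoc[symmetric] power_add[symmetric])
qed

text \<open>Euclid's algorithm: passing from \<open>F\<close> to a nonzero remainder
  \<open>H = F mod G\<close> changes both sides by the same sign and power of
  \<open>lead_coeff G\<close>. For root products this holds because \<open>F\<close> and
  \<open>H\<close> agree at the roots of \<open>G\<close>, for determinants by the recursion of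
  subresultants. If \<open>H = 0\<close> and \<open>G\<close> is nonconstant, both sides
  vanish.\<close>

lemma resultant_eq_root_resultant_aux:
  "F \<noteq> 0 \<Longrightarrow> G \<noteq> 0 \<Longrightarrow> degree G \<le> degree F \<Longrightarrow> resultant F G = root_resultant F G"
proof (induction "degree G" arbitrary: F G rule: less_induct)
  case less
  show ?case
  proof (cases "degree G = 0")
    case True
    then obtain c where "G = [:c:]"
      by (elim degree_eq_zeroE)
    then show ?thesis
      using less.prems by (simp add: root_resultant_def alg_closed_proots(1))
  next
    case False
    define H where "H = F mod G"
    define B where "B = - (F div G)"
    have eq: "F + B * G = H"
      unfolding H_def B_def by (metis add_diff_cancel_left' add_uminus_conv_diff
          div_mult_mod_eq mult_minus_left)
    have dH: "degree H < degree G"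
      unfolding H_def using False less.prems by (metis degree_0 degree_mod_less not_gr_zero)
    have "root_resultant F G = (-1) ^ (degree F * degree G) * root_resultant G F"
      using less.prems by (intro root_resultant_swap)
    also have "\<dots> = (-1) ^ (degree F * degree G) * lead_coeff G ^ (degree F - degree H) *
        root_resultant G H"
      using root_resultant_add_mult[OF eq] less.prems dH by simp
    finally have R: "root_resultant F G =
        (-1) ^ (degree F * degree G) * lead_coeff G ^ (degree F - degree H) * root_resultant G H" .
    have choice: "degree H < degree G \<or> b" for b
      using dH by simp
    show ?thesis
    proof (cases "H = 0")
      case True
      obtain y where y: "poly G y = 0"
        using False alg_closed_imp_poly_has_root[of G] by auto
      then have "root_resultant G H = 0"
        using True less.prems using False by (auto simp: root_resultant_def alg_closed_proots(1))
      moreover have "F = (F div G) * G"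
        using True by (simp add: H_def) (metis add.right_neutral div_mult_mod_eq)
      then have "subresultant 0 F G = 0"
        using subresultant_product[of F "F div G" G 0] less.prems False by simp
      ultimately show ?thesis
        using R by (simp add: subresultant_resultant)
    next
      case H: False
      show ?thesis
      proof (cases "degree H = 0")
        case True
        then obtain c where c: "H = [:c:]"
          by (elim degree_eq_zeroE)
        have "subresultant 0 F G = smult ((-1) ^ (degree F * degree G) * lead_coeff G ^ degree F *
            c ^ (degree G - 1)) [:c:]"
          using BT_lemma_1_13[OF eq less.prems(3) choice choice] True c by simp
        then show ?thesis
          using R c less.prems False
          by (simp add: subresultant_resultant root_resultant_def alg_closed_proots(1)
              power_eq_if[of c "degree G"] mult_ac)
      next
        case pos: False
        have "subresultant 0 F G = smult ((-1) ^ (degree F * degree G) *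
            lead_coeff G ^ (degree F - degree H)) (subresultant 0 G H)"
          using BT_lemma_1_12[OF eq less.prems(3) choice, of 0] pos by simp
        moreover have "resultant G H = root_resultant G H"
          using less.hyps[of H G] dH less.prems H by simp
        ultimately show ?thesis
          using R by (simp add: subresultant_resultant)
      qed
    qed
  qed
qed

lemma resultant_eq_prod_roots:
  fixes F G :: "'b::alg_closed_field poly"
  assumes "F \<noteq> 0" "G \<noteq> 0"
  shows "resultant F G = lead_coeff F ^ degree G * (\<Prod>x\<in>#proots F. poly G x)"
proof -
  have "resultant F G = root_resultant F G"
  proof (cases "degree G \<le> degree F")
    case True
    then show ?thesis
      using assms resultant_eq_root_resultant_aux by blast
  next
    case False
    then have "resultant G F = root_resultant G F"
      using assms by (intro resultant_eq_root_resultant_aux) auto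
    then show ?thesis
      using resultant_swap[of F G] root_resultant_swap[of F G] assms by simp
  qed
  then show ?thesis
    by (simp add: root_resultant_def)
qed

lemma rts_mono:
  assumes "F dvd f" "f \<noteq> 0"
  shows "rts F \<subseteq># rts f"
proof -
  obtain c where "f = F * c"
    using assms(1) by (elim dvdE)
  then show ?thesis
    using assms(2) by (simp add: rts_mult)
qed

section \<open>Irreducible factors\<close>

context complete_valuation
begin

lemma carrier_int_poly_ring [simp]: "carrier (int_poly_ring v) = int_polys v"
  and mult_int_poly_ring [simp]: "monoid.mult (int_poly_ring v) f g = f * g"
  and one_int_poly_ring [simp]: "monoid.one (int_poly_ring v) = 1"
  and zero_int_poly_ring [simp]: "ring.zero (int_poly_ring v) = 0"
  by (simp_all add: int_poly_ring_def ring_of_type_algebra_def)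

text \<open>The quotient of two monic integral polynomials is monic with integral roots, so division
  over the field already takes place over the valuation ring.\<close>

lemma divides_int_poly_ring_iff:
  assumes "F \<in> int_polys v" "lead_coeff F = 1" "f \<in> int_polys v" "lead_coeff f = 1"
  shows "F divides\<^bsub>int_poly_ring v\<^esub> f \<longleftrightarrow> F dvd f"
proof
  assume "F dvd f"
  then obtain c where c: "f = F * c"
    by (elim dvdE)
  then have "lead_coeff c = 1"
    using assms lead_coeff_mult[of F c] by simp
  then have "c \<in> int_polys v"
    using c assms by (intro int_polys_of_dvd[of c f]) auto
  then show "F divides\<^bsub>int_poly_ring v\<^esub> f"
    using c by (auto simp: factor_def)
qed (auto simp: factor_def)

lemma monic_irreducibles_int: "F \<in> monic_irreducibles v \<Longrightarrow> F \<in> int_polys v"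
  and monic_irreducibles_monic: "F \<in> monic_irreducibles v \<Longrightarrow> lead_coeff F = 1"
  by (auto simp: monic_irreducibles_def)

lemma monic_irreducibles_nonzero: "F \<in> monic_irreducibles v \<Longrightarrow> F \<noteq> 0"
  using monic_nonzero monic_irreducibles_monic by blast

lemma monic_irreducibles_degree_pos:
  assumes "F \<in> monic_irreducibles v"
  shows "degree F > 0"
proof (rule ccontr)
  assume "\<not> degree F > 0"
  then obtain c where c: "F = [:c:]"
    by (auto elim: degree_eq_zeroE)
  then have "F = 1"
    using monic_irreducibles_monic[OF assms] by simp
  then have "F \<in> Units (int_poly_ring v)"
    by (auto simp: Units_def)
  then show False
    using assms by (auto simp: monic_irreducibles_def ring_irreducible_def Divisibility.irreducible_def)
qed

lemma not_Units_of_degree_pos: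
  assumes "0 < degree m"
  shows "m \<notin> Units (int_poly_ring v)"
proof
  assume "m \<in> Units (int_poly_ring v)"
  then obtain u where u: "m * u = 1"
    by (auto simp: Units_def)
  then have "m \<noteq> 0" "u \<noteq> 0"
    by auto
  with u have "degree m + degree u = 0"
    using degree_mult_eq[of m u] by simp
  then show False
    using assms by simp
qed

section \<open>Minimal polynomials and the roots of monic irreducibles\<close>

lemma minimal_poly_exists:
  fixes x :: "'k alg_closure"
  obtains m where "lead_coeff m = 1" "poly (ac_poly m) x = 0" "degree m > 0"
    "\<And>h. h \<noteq> 0 \<Longrightarrow> poly (ac_poly h) x = 0 \<Longrightarrow> degree m \<le> degree h"
    "\<And>h. poly (ac_poly h) x = 0 \<Longrightarrow> m dvd h"
proof -
  define P where "P h \<longleftrightarrow> h \<noteq> 0 \<and> poly (ac_poly h) x = 0" for h :: "'k poly"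
  obtain h0 :: "'k poly" where "P h0"
    using alg_closure_algebraic[of x] by (auto simp: P_def)
  then obtain m0 where m0: "P m0" "\<And>h. P h \<Longrightarrow> degree m0 \<le> degree h"
    using ex_has_least_nat[of P h0 degree] by blast
  define m where "m = smult (inverse (lead_coeff m0)) m0"
  have "m0 \<noteq> 0"
    using m0 by (simp add: P_def)
  then have m: "lead_coeff m = 1" "poly (ac_poly m) x = 0" "degree m = degree m0"
    using m0(1) by (auto simp: m_def P_def to_ac.map_poly_hom_smult)
  have minimal: "degree m \<le> degree h" if "h \<noteq> 0" "poly (ac_poly h) x = 0" for h
    using m0(2)[of h] m(3) that by (simp add: P_def)
  have dvd: "m dvd h" if "poly (ac_poly h) x = 0" for h
  proof -
    have "poly (ac_poly (h mod m)) x = poly (ac_poly (h - h div m * m)) x"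
      by (simp add: minus_div_mult_eq_mod)
    also have "\<dots> = 0"
      using that m(2) by (simp add: to_ac_poly.hom_minus to_ac_poly.hom_mult)
    finally have root: "poly (ac_poly (h mod m)) x = 0" .
    have "m \<noteq> 0"
      using m(1) by auto
    then have "h mod m = 0"
      using minimal[OF _ root] degree_mod_less[of m h] by force
    then show ?thesis
      by (simp add: mod_eq_0_iff_dvd)
  qed
  have "degree m > 0"
    using m(1,2) by (intro Nat.gr0I) (auto elim!: degree_eq_zeroE)
  with m(1,2) show thesis
    using minimal dvd by (rule that)
qed

text \<open>The minimal polynomial of \<open>x\<close> divides \<open>F\<close> and is integral. As
  a nonunit it is not a proper factor of the irreducible \<open>F\<close>, so \<open>F\<close>
  divides it in turn.\<close>

lemma monic_irreducibles_dvd: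
  assumes F: "F \<in> monic_irreducibles v" and root: "poly (ac_poly F) x = 0"
    and h: "poly (ac_poly h) x = 0"
  shows "F dvd h"
proof -
  obtain m :: "'k poly" where m: "lead_coeff m = 1" "degree m > 0"
    "\<And>h. poly (ac_poly h) x = 0 \<Longrightarrow> m dvd h"
    using minimal_poly_exists[of x] by metis
  have "m dvd F"
    using m(3) root .
  moreover have m_int: "m \<in> int_polys v"
    using int_polys_of_dvd[OF \<open>m dvd F\<close>] m(1) F by (auto simp: monic_irreducibles_def)
  moreover have "m \<notin> Units (int_poly_ring v)"
    using m(2) by (rule not_Units_of_degree_pos)
  ultimately have "F dvd m"
    using F m(1) divides_int_poly_ring_iff[of m F] divides_int_poly_ring_iff[of F m]
    unfolding monic_irreducibles_def ring_irreducible_def Divisibility.irreducible_def properfactor_def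
    by auto
  then show ?thesis
    using m(3)[OF h] by (rule dvd_trans)
qed

lemma monic_irreducibles_exists:
  assumes f: "f \<in> int_polys v" "lead_coeff f = 1" "x \<in># rts f"
  obtains F where "F \<in> monic_irreducibles v" "x \<in># rts F"
proof -
  obtain m :: "'k poly" where m: "lead_coeff m = 1" "poly (ac_poly m) x = 0" "degree m > 0"
    "\<And>h. h \<noteq> 0 \<Longrightarrow> poly (ac_poly h) x = 0 \<Longrightarrow> degree m \<le> degree h"
    "\<And>h. poly (ac_poly h) x = 0 \<Longrightarrow> m dvd h"
    by (rule minimal_poly_exists[of x]) (rule that)
  have f0: "f \<noteq> 0" and m0: "m \<noteq> 0"
    using f(2) m(1) by auto
  have m_int: "m \<in> int_polys v"
    using int_polys_of_dvd[of m f] m(1,5) f f0 by (simp add: in_rts_iff)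
  have "m \<notin> Units (int_poly_ring v)"
    using m(3) by (rule not_Units_of_degree_pos)
  moreover have "b \<in> Units (int_poly_ring v)"
    if b: "b \<in> int_polys v" "properfactor (int_poly_ring v) b m" for b
  proof -
    obtain c where c: "c \<in> int_polys v" "m = b * c"
      using b(2) by (auto simp: properfactor_def factor_def)
    have nz: "b \<noteq> 0" "c \<noteq> 0"
      using c m0 by auto
    have lc: "lead_coeff b * lead_coeff c = 1"
      using c m(1) lead_coeff_mult[of b c] by simp
    have deg: "degree m = degree b + degree c"
      using c nz by (simp add: degree_mult_eq)
    have "poly (ac_poly b) x = 0 \<or> poly (ac_poly c) x = 0"
      using m(2) c by (simp add: to_ac_poly.hom_mult)
    then show ?thesis
    proof
      assume "poly (ac_poly b) x = 0"
      then have "degree c = 0"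
        using m(4)[of b] nz deg by simp
      then obtain c0 where c0: "c = [:c0:]"
        by (elim degree_eq_zeroE)
      \<comment> \<open>As \<open>m\<close> is monic, the constant \<open>c\<close> is inverse to
        \<open>lead_coeff b\<close>, which is integral as a coefficient of \<open>b\<close>.\<close>
      then have "b = m * [:lead_coeff b:]"
        using c lc by (simp add: mult.commute)
      moreover have "[:lead_coeff b:] \<in> int_polys v"
        using b(1) unfolding base.const_in_int_polys_iff by (simp add: int_polys_def)
      ultimately have "m divides\<^bsub>int_poly_ring v\<^esub> b"
        by (auto simp: factor_def simp del: mult_pCons_right)
      then show ?thesis
        using b(2) by (simp add: properfactor_def)
    next
      assume "poly (ac_poly c) x = 0"
      then have "degree b = 0"
        using m(4)[of c] nz deg by simp
      then obtain b0 where b0: "b = [:b0:]"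
        by (elim degree_eq_zeroE)
      then have "b * [:lead_coeff c:] = 1" "[:lead_coeff c:] * b = 1"
        using lc by (auto simp: mult.commute)
      moreover have "[:lead_coeff c:] \<in> int_polys v"
        using c(1) unfolding base.const_in_int_polys_iff by (simp add: int_polys_def)
      ultimately show ?thesis
        using b(1) unfolding Units_def by (auto simp del: mult_pCons_left mult_pCons_right)
    qed
  qed
  ultimately have "m \<in> monic_irreducibles v"
    using m_int m0 m(1)
    by (auto simp: monic_irreducibles_def ring_irreducible_def Divisibility.irreducible_def)
  then show thesis
    using that m(2) m0 by (auto simp: in_rts_iff)
qed

lemma rts_eqI:
  assumes "F \<in> monic_irreducibles v" "G \<in> monic_irreducibles v" "x \<in># rts F" "x \<in># rts G"
  shows "F = G"
proof -
  have "F dvd G" "G dvd F"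
    using assms monic_irreducibles_dvd[of F x G] monic_irreducibles_dvd[of G x F]
    by (auto simp: in_rts_iff monic_irreducibles_nonzero)
  then show ?thesis
    using monic_eqI_dvd[of F G] dvd_imp_degree_le[of G F] assms
    by (auto simp: monic_irreducibles_monic monic_irreducibles_nonzero)
qed

lemma monic_irreducibles_rts_nonempty:
  assumes "F \<in> monic_irreducibles v"
  obtains x where "x \<in># rts F"
  using assms size_rts[of F] monic_irreducibles_degree_pos[of F] monic_irreducibles_nonzero[of F]
  by (metis less_irrefl multiset_nonemptyE size_empty)

text \<open>\<open>F\<close> has least degree among the nonzero polynomials vanishing at any one of
  its roots, so the one-sided estimate applies in both directions. Through this lemma the
  completeness of the base field enters all that follows.\<close>

lemma val_conjugate:
  assumes F: "F \<in> monic_irreducibles v" and x: "x \<in># rts F" and y: "y \<in># rts F"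
  shows "val h x = val h y"
proof -
  have le: "val h x \<le> val h y" if "x \<in># rts F" "y \<in># rts F" for x y
  proof (rule val_conjugate_le[of F])
    show "degree F \<le> degree h" if "h \<noteq> 0" "poly (ac_poly h) x = 0" for h
      using that F \<open>x \<in># rts F\<close>
      by (intro dvd_imp_degree_le monic_irreducibles_dvd[of F x])
        (auto simp: in_rts_iff monic_irreducibles_nonzero)
  qed (use that F rts_nonneg[of F] in
      \<open>auto simp: in_rts_iff monic_irreducibles_nonzero monic_irreducibles_monic monic_irreducibles_int\<close>)
  show ?thesis
    using le[OF x y] le[OF y x] by (rule antisym)
qed

section \<open>Sums over conjugate roots, reciprocity and resultants\<close>

lemma sum_mset_const_ereal:
  assumes "\<And>x. x \<in># A \<Longrightarrow> f x = c" "0 \<le> c"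
  shows "(\<Sum>x\<in>#A. f x) = ereal (real (size A)) * c"
  using assms(1)
proof (induction A)
  case (add x A)
  have "ereal (real (Suc n)) * c = c + ereal (real n) * c" for n
    using \<open>0 \<le> c\<close> by (cases c; cases n) (auto simp: algebra_simps)
  then show ?case
    using add by simp
qed (simp add: zero_ereal_def[symmetric])

lemma sum_val_rts:
  assumes "F \<in> monic_irreducibles v" "x \<in># rts F" "h \<in> int_polys v"
  shows "(\<Sum>y\<in>#rts F. val h y) = ereal (real (degree F)) * val h x"
proof -
  have "0 \<le> w x"
    using assms rts_nonneg monic_irreducibles_monic monic_irreducibles_int by blast
  then have "(\<Sum>y\<in>#rts F. val h y) = ereal (real (size (rts F))) * val h x"
    using assms by (intro sum_mset_const_ereal val_conjugate[of F] val_nonneg)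
  then show ?thesis
    using assms(1) by (simp add: size_rts monic_irreducibles_nonzero)
qed

text \<open>Both sides are the sum of \<open>w (x - y)\<close> over all pairs of roots.\<close>

lemma sum_val_swap:
  assumes "lead_coeff f = 1" "lead_coeff g = 1"
  shows "(\<Sum>x\<in>#rts f. val g x) = (\<Sum>y\<in>#rts g. val f y)"
proof -
  have "(\<Sum>x\<in>#rts f. val g x) = (\<Sum>x\<in>#rts f. \<Sum>y\<in>#rts g. w (x - y))"
    using assms by (simp add: val_eq_sum_rts)
  also have "\<dots> = (\<Sum>y\<in>#rts g. \<Sum>x\<in>#rts f. w (y - x))"
    by (subst sum_mset.swap) (intro arg_cong[of _ _ sum_mset] image_mset_cong val_minus_commute)
  also have "\<dots> = (\<Sum>y\<in>#rts g. val f y)"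
    using assms by (simp add: val_eq_sum_rts)
  finally show ?thesis .
qed

lemma val_reciprocity:
  assumes "F \<in> monic_irreducibles v" "G \<in> monic_irreducibles v" "x \<in># rts F" "y \<in># rts G"
  shows "ereal (real (degree F)) * val G x = ereal (real (degree G)) * val F y"
  using sum_val_rts[of F x G] sum_val_rts[of G y F] sum_val_swap[of F G] assms
  by (simp add: monic_irreducibles_monic monic_irreducibles_int)

lemma val_resultant:
  assumes F: "F \<in> monic_irreducibles v" and G: "G \<in> monic_irreducibles v" and x: "x \<in># rts F"
  shows "v (resultant F G) = ereal (real (degree F)) * val G x"
proof -
  have "v (resultant F G) = w (resultant (ac_poly F) (ac_poly G))"
    by (simp add: to_ac.resultant_hom ext)
  also have "\<dots> = w (\<Prod>y\<in>#rts F. poly (ac_poly G) y)"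
    using F G monic_irreducibles_monic[OF F]
    by (subst resultant_eq_prod_roots) (auto simp: monic_irreducibles_nonzero rts_def)
  also have "\<dots> = (\<Sum>y\<in>#rts F. val G y)"
    by (simp add: val_prod_mset val_at_def)
  also have "\<dots> = ereal (real (degree F)) * val G x"
    using sum_val_rts F x G monic_irreducibles_int by blast
  finally show ?thesis .
qed

subsection \<open>Decomposition of a separable polynomial\<close>

lemma irreducible_factors_iff:
  assumes "f \<in> int_polys v" "lead_coeff f = 1"
  shows "F \<in> irreducible_factors v f \<longleftrightarrow> F \<in> monic_irreducibles v \<and> F dvd f"
  using divides_int_poly_ring_iff[of F f] assms
  by (auto simp: irreducible_factors_def monic_irreducibles_def)

lemma irreducible_factor_of_root:
  assumes f: "f \<in> int_polys v" "lead_coeff f = 1" "x \<in># rts f"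
  obtains F where "F \<in> irreducible_factors v f" "x \<in># rts F"
proof -
  obtain F where F: "F \<in> monic_irreducibles v" "x \<in># rts F"
    using monic_irreducibles_exists[OF f] .
  then have "F dvd f"
    using f monic_nonzero[OF f(2)]
    by (intro monic_irreducibles_dvd) (auto simp: in_rts_iff monic_irreducibles_nonzero)
  then show thesis
    using that F f by (simp add: irreducible_factors_iff)
qed

text \<open>Distinct irreducibles share no root, so picking one root from each factor injects the
  factors into the finitely many roots of \<open>f\<close>.\<close>

lemma finite_irreducible_factors:
  assumes f: "f \<in> int_polys v" "lead_coeff f = 1"
  shows "finite (irreducible_factors v f)"
proof -
  have "\<exists>x. x \<in># rts f \<and> x \<in># rts F" if "F \<in> irreducible_factors v f" for F
  proof -
    have F: "F \<in> monic_irreducibles v" "F dvd f"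
      using that f by (auto simp: irreducible_factors_iff)
    obtain x where "x \<in># rts F"
      using monic_irreducibles_rts_nonempty[OF F(1)] .
    moreover have "f \<noteq> 0"
      using f by auto
    ultimately show ?thesis
      using rts_mono[OF F(2)] by (meson mset_subset_eqD)
  qed
  then obtain r where r: "\<And>F. F \<in> irreducible_factors v f \<Longrightarrow> r F \<in># rts f \<and> r F \<in># rts F"
    by metis
  have "inj_on r (irreducible_factors v f)"
    using r f by (intro inj_onI) (metis irreducible_factors_iff rts_eqI)
  moreover have "r ` irreducible_factors v f \<subseteq> set_mset (rts f)"
    using r by auto
  ultimately show ?thesis
    by (meson finite_imageD finite_set_mset finite_subset)
qed

text \<open>Each root of \<open>f\<close> belongs to exactly one irreducible factor, and
  separability bounds all multiplicities by one.\<close>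

lemma rts_eq_sum_irreducible_factors:
  assumes f: "f \<in> int_polys v" "lead_coeff f = 1" "separable_poly f"
  shows "rts f = (\<Sum>F\<in>irreducible_factors v f. rts F)"
proof (rule multiset_eqI)
  fix x
  let ?S = "irreducible_factors v f"
  have f0: "f \<noteq> 0"
    using f by auto
  have fin: "finite ?S"
    using f by (intro finite_irreducible_factors)
  have simple: "count (rts f) x \<le> 1" for x
    using f(3) f0 by (auto simp: separable_poly_def rsquarefree_def rts_def)
      (metis One_nat_def le_numeral_extra(4) zero_le)
  have le: "count (rts F) x \<le> count (rts f) x" if "F \<in> ?S" for F
    using that f f0 rts_mono[of F f] by (auto simp: irreducible_factors_iff mset_subset_eq_count)
  have sum: "count (\<Sum>F\<in>?S. rts F) x = (\<Sum>F\<in>?S. count (rts F) x)"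
    by (simp add: count_sum)
  show "count (rts f) x = count (\<Sum>F\<in>?S. rts F) x"
  proof (cases "x \<in># rts f")
    case True
    then obtain F where F: "F \<in> ?S" "x \<in># rts F"
      using f irreducible_factor_of_root by blast
    have "count (rts G) x = 0" if "G \<in> ?S - {F}" for G
      using that F f rts_eqI[of F G x] by (auto simp: irreducible_factors_iff not_in_iff[symmetric])
    then have "(\<Sum>F\<in>?S. count (rts F) x) = count (rts F) x"
      using fin F(1) by (subst sum.remove[of _ F]) auto
    moreover have "count (rts F) x = count (rts f) x"
      using le[OF F(1)] simple[of x] F(2) by (simp add: count_greater_zero_iff[symmetric] del: count_greater_zero_iff)
    ultimately show ?thesis
      using sum by simp
  next
    case False
    then have "count (rts F) x = 0" if "F \<in> ?S" for F
      using le[OF that] by (simp add: not_in_iff)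
    then show ?thesis
      using False sum by (simp add: not_in_iff)
  qed
qed

lemma degree_eq_sum_irreducible_factors:
  assumes f: "f \<in> int_polys v" "lead_coeff f = 1" "separable_poly f"
  shows "degree f = (\<Sum>F\<in>irreducible_factors v f. degree F)"
proof -
  have "degree f = size (\<Sum>F\<in>irreducible_factors v f. rts F)"
    using rts_eq_sum_irreducible_factors[OF f] monic_nonzero[OF f(2)] size_rts[of f] by simp
  also have "\<dots> = (\<Sum>F\<in>irreducible_factors v f. size (rts F))"
    by (induction "irreducible_factors v f" rule: infinite_finite_induct) auto
  also have "\<dots> = (\<Sum>F\<in>irreducible_factors v f. degree F)"
    using f by (auto simp: irreducible_factors_iff size_rts monic_irreducibles_nonzero
        intro!: sum.cong)
  finally show ?thesis .
qed

end

lemma member_le_sum_ereal: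
  fixes h :: "'b \<Rightarrow> ereal"
  assumes "finite A" "x \<in> A" "\<And>y. y \<in> A \<Longrightarrow> 0 \<le> h y"
  shows "h x \<le> sum h A"
proof -
  have "h x + 0 \<le> h x + sum h (A - {x})"
    using assms by (intro add_left_mono sum_nonneg) auto
  then show ?thesis
    using assms by (simp add: sum.remove)
qed

lemma sum_mset_sum: "(\<Sum>y\<in>#(\<Sum>i\<in>I. A i). h y) = (\<Sum>i\<in>I. \<Sum>y\<in>#A i. h y)"
  by (induction I rule: infinite_finite_induct) auto

section \<open>Truncated root distances\<close>

context complete_valuation
begin

text \<open>For \<open>r = w t\<close> this is the Gauss valuation of the polynomial with roots \<open>A\<close> on the ball with
  centre \<open>x\<close> and radius \<open>r\<close>, i.e. the minimum of \<open>w\<close> over the coefficients after substituting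
  \<open>x + t X\<close>.\<close>

definition capped :: "'k alg_closure multiset \<Rightarrow> 'k alg_closure \<Rightarrow> ereal \<Rightarrow> ereal" where
  "capped A x r = (\<Sum>y\<in>#A. min r (w (x - y)))"

lemma capped_le_val: "lead_coeff h = 1 \<Longrightarrow> capped (rts h) x r \<le> val h x"
  by (auto simp: capped_def val_eq_sum_rts intro!: sum_mset_mono)

lemma capped_eq_val:
  assumes "lead_coeff h = 1" "\<And>y. y \<in># rts h \<Longrightarrow> w (x - y) \<le> r"
  shows "capped (rts h) x r = val h x"
  unfolding capped_def val_eq_sum_rts[OF assms(1)]
  using assms(2) by (intro arg_cong[of _ _ sum_mset] image_mset_cong) (simp add: min_absorb2)

lemma capped_cong: "r \<le> w (x - y) \<Longrightarrow> capped A x r = capped A y r"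
  unfolding capped_def by (intro arg_cong[of _ _ sum_mset] image_mset_cong min_val_diff_cong)

lemma capped_le_val_close: "lead_coeff h = 1 \<Longrightarrow> r \<le> w (x - y) \<Longrightarrow> capped (rts h) x r \<le> val h y"
  using capped_le_val[of h y r] capped_cong[of r x y] by simp

lemma capped_sum: "capped (\<Sum>i\<in>I. A i) x r = (\<Sum>i\<in>I. capped (A i) x r)"
  by (simp add: capped_def sum_mset_sum)

lemma nearest_exists:
  assumes "x0 \<in># A"
  obtains x where "x \<in># A" "\<And>x'. x' \<in># A \<Longrightarrow> w (y - x') \<le> w (y - x)"
proof -
  have "Max ((\<lambda>x. w (y - x)) ` set_mset A) \<in> (\<lambda>x. w (y - x)) ` set_mset A"
    using assms by (intro Max_in) auto
  then obtain x where "x \<in># A" "w (y - x) = Max ((\<lambda>x. w (y - x)) ` set_mset A)"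
    by auto
  then show thesis
    by (intro that[of x]) auto
qed

text \<open>Since \<open>a\<close> is at least as near to \<open>y\<close> as each root is, passing
  from \<open>y\<close> to \<open>a\<close> cannot increase the distance to that root.\<close>

lemma val_le_of_closer:
  assumes "lead_coeff h = 1" "\<And>x. x \<in># rts h \<Longrightarrow> w (y - x) \<le> w (y - a)"
  shows "val h y \<le> val h a"
  unfolding val_eq_sum_rts[OF assms(1)]
proof (intro sum_mset_mono)
  fix x assume "x \<in># rts h"
  then show "w (y - x) \<le> w (a - x)"
    using assms(2)[of x] close_trans[of "w (y - x)" a y x] by (simp add: val_minus_commute[of a y])
qed

lemma coeff_pcompose_ge:
  assumes "\<And>i. s \<le> w (coeff h i)" "l \<in> int_polys w"
  shows "s \<le> w (coeff (pcompose h l) i)"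
  using assms(1)
proof (induction h arbitrary: i)
  case (pCons a h)
  have "s \<le> w a"
    using pCons.prems[of 0] by simp
  moreover have "s \<le> w (coeff (pcompose h l) i)" for i
    using pCons.prems[of "Suc _"] by (intro pCons.IH) simp
  then have "s \<le> w (coeff (l * pcompose h l) i)"
    using assms(2) unfolding coeff_mult
    by (intro val_sum_geI) (auto simp: val_mult int_polys_def intro: add_increasing)
  ultimately show ?case
    unfolding pcompose_pCons coeff_add by (intro val_add_geI) (auto simp: coeff_pCons split: nat.split)
qed simp

text \<open>The congruence survives the integral substitution of \<open>x + t X\<close>, after which
  \<open>capped\<close> is the least coefficient valuation. Thus a bound on a whole ball, and not
  just at one point, passes from \<open>g\<close> to \<open>f\<close>.\<close>

lemma capped_ge_of_congruent:
  assumes f: "lead_coeff f = 1" and g: "lead_coeff g = 1"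
    and cong: "\<And>i. s \<le> v (coeff (g - f) i)"
    and xt: "0 \<le> w x" "0 \<le> w t"
    and ge: "s \<le> capped (rts g) x (w t)"
  shows "s \<le> capped (rts f) x (w t)"
proof -
  define l where "l = [:x, t:]"
  have l: "l \<in> int_polys w"
    using xt by (simp add: l_def)
  have expand: "pcompose (ac_poly h) l = (\<Prod>y\<in>#rts h. [:x - y, t:])" if "lead_coeff h = 1" for h
  proof -
    have "pcompose (\<Prod>y\<in>#A. [:- y, 1:]) l = (\<Prod>y\<in>#A. [:x - y, t:])" for A
      by (induction A) (auto simp: pcompose_mult pcompose_pCons l_def simp del: mult_pCons_left)
    moreover have "ac_poly h = (\<Prod>y\<in>#rts h. [:- y, 1:])"
      using alg_closed_proots(2)[of "ac_poly h"] monic_nonzero[OF that] that by (simp add: rts_def)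
    ultimately show ?thesis
      by simp
  qed
  obtain i where i: "w (coeff (pcompose (ac_poly f) l) i) = capped (rts f) x (w t)"
    using val_coeff_prod_linear[where A = "rts f" and a = "\<lambda>y. x - y" and t = t]
    unfolding expand[OF f] capped_def min.commute[of "w t"] by blast
  have "capped (rts g) x (w t) \<le> w (coeff (pcompose (ac_poly g) l) i)"
    using val_coeff_prod_linear[where A = "rts g" and a = "\<lambda>y. x - y" and t = t]
    unfolding expand[OF g] capped_def min.commute[of "w t"] by blast
  then have "s \<le> w (coeff (pcompose (ac_poly g) l) i)"
    using ge by order
  moreover have "s \<le> w (coeff (pcompose (ac_poly (g - f)) l) i)"
    using cong l by (intro coeff_pcompose_ge) (simp_all only: coeff_map_poly to_ac_0 ext)
  ultimately have "s \<le> w (coeff (pcompose (ac_poly g) l) i - coeff (pcompose (ac_poly (g - f)) l) i)"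
    by (rule val_diff_geI)
  also have "coeff (pcompose (ac_poly g) l) i - coeff (pcompose (ac_poly (g - f)) l) i =
      coeff (pcompose (ac_poly f) l) i"
    by (simp add: to_ac_poly.hom_minus pcompose_diff)
  finally show ?thesis
    using i by simp
qed

lemma val_root_of_congruent:
  assumes cong: "\<And>i. s \<le> v (coeff (g - f) i)" and x: "0 \<le> w x"
    and root: "poly (ac_poly g) x = 0 \<or> poly (ac_poly f) x = 0"
  shows "s \<le> val f x" "s \<le> val g x"
proof -
  have "s \<le> val (g - f) x"
    using cong x by (rule val_ge_of_coeffs)
  then show "s \<le> val f x" "s \<le> val g x"
    using root by (auto simp: val_at_def to_ac_poly.hom_minus)
qed

section \<open>The Okutsu bound\<close>

lemma okutsu_bound_nonneg:
  assumes "0 \<le> w x"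
  shows "0 \<le> okutsu_bound v w F x"
proof (cases "degree F \<le> 1")
  case False
  let ?H = "{h \<in> int_polys v. lead_coeff h = 1 \<and> 0 < degree h \<and> degree h < degree F}"
  have "0 \<le> slope w [:0, 1:] x"
    using assms by (simp add: slope_def val_at_def map_poly_pCons)
  also have "\<dots> \<le> (SUP h\<in>?H. slope w h x)"
    using False by (intro SUP_upper) auto
  finally show ?thesis
    using False by (simp add: okutsu_bound_def)
qed (simp add: okutsu_bound_def)

text \<open>Cleared of denominators, so that it also covers the constant \<open>h = 1\<close>, which
  is excluded from the supremum and for which both sides are zero.\<close>

lemma val_le_okutsu_bound:
  assumes h: "h \<in> int_polys v" "lead_coeff h = 1" "degree h < degree F"
  shows "ereal (real (degree F)) * val h x \<le> ereal (real (degree h)) * okutsu_bound v w F x"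
proof (cases "degree h = 0")
  case True
  then have "h = 1"
    using h(2) by (auto elim!: degree_eq_zeroE)
  then show ?thesis
    by (simp add: val_at_def zero_ereal_def[symmetric])
next
  case False
  define s where "s = (SUP h \<in> {h \<in> int_polys v. lead_coeff h = 1 \<and> 0 < degree h \<and>
      degree h < degree F}. slope w h x)"
  have "slope w h x \<le> s"
    unfolding s_def using h False by (intro SUP_upper) auto
  moreover have "okutsu_bound v w F x = ereal (real (degree F)) * s"
    using False h by (simp add: okutsu_bound_def s_def)
  ultimately show ?thesis
    using False h(3) unfolding slope_def
    by (cases s; cases "val h x") (auto simp: field_simps)
qed

text \<open>An \<open>H\<close> of smaller degree would compete in the supremum; reciprocity turns
  its value at \<open>x\<close> into the value of \<open>F\<close> at \<open>y\<close>, which would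
  then be too small.\<close>

lemma degree_le_of_okutsu_bound_less:
  assumes F: "F \<in> monic_irreducibles v" "x \<in># rts F"
    and H: "H \<in> monic_irreducibles v" "y \<in># rts H"
    and less: "okutsu_bound v w F x < val F y"
  shows "degree F \<le> degree H"
proof (rule ccontr)
  assume "\<not> degree F \<le> degree H"
  then have "ereal (real (degree F)) * val H x \<le> ereal (real (degree H)) * okutsu_bound v w F x"
    using H by (intro val_le_okutsu_bound monic_irreducibles_int monic_irreducibles_monic) auto
  also have "ereal (real (degree F)) * val H x = ereal (real (degree H)) * val F y"
    using F H by (intro val_reciprocity)
  finally show False
    using less monic_irreducibles_degree_pos[OF H(1)]
    by (cases "val F y"; cases "okutsu_bound v w F x") auto
qed

end

section \<open>The invariant of a separable polynomial\<close>

locale separable_factorisation = complete_valuation v w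
  for v :: "'k::field \<Rightarrow> ereal" and w :: "'k alg_closure \<Rightarrow> ereal" +
  fixes \<theta> :: "'k poly \<Rightarrow> 'k alg_closure" and f :: "'k poly"
  assumes root: "F \<in> monic_irreducibles v \<Longrightarrow> \<theta> F \<in># rts F"
    and f_int: "f \<in> int_polys v" and f_monic: "lead_coeff f = 1" and f_separable: "separable_poly f"
begin

abbreviation factors_f where "factors_f \<equiv> irreducible_factors v f"

abbreviation bound where "bound F \<equiv> okutsu_bound v w F (\<theta> F)"

text \<open>The valuation at \<open>\<theta> F\<close> of the cofactor of \<open>F\<close> in
  \<open>f\<close>. Multiplied by \<open>degree F\<close> it is the share of \<open>F\<close> in the
  resultant sum of \<open>delta_star\<close>.\<close>

definition interaction :: "'k poly \<Rightarrow> ereal" where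
  "interaction F = (\<Sum>G\<in>factors_f - {F}. val G (\<theta> F))"

lemma finite_factors: "finite factors_f"
  by (rule finite_irreducible_factors[OF f_int f_monic])

lemma factor_irreducible: "F \<in> factors_f \<Longrightarrow> F \<in> monic_irreducibles v"
  by (simp add: irreducible_factors_iff f_int f_monic)

lemma factor_root: "F \<in> factors_f \<Longrightarrow> \<theta> F \<in># rts f"
  using root[of F] rts_mono[of F f] monic_nonzero[OF f_monic]
  by (auto simp: irreducible_factors_iff f_int f_monic dest: mset_subset_eqD)

lemma root_nonneg: "F \<in> monic_irreducibles v \<Longrightarrow> 0 \<le> w (\<theta> F)"
  using root rts_nonneg monic_irreducibles_int monic_irreducibles_monic by blast

lemma bound_nonneg: "F \<in> monic_irreducibles v \<Longrightarrow> 0 \<le> bound F"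
  by (intro okutsu_bound_nonneg root_nonneg)

lemma val_factor_root_nonneg:
  "F \<in> monic_irreducibles v \<Longrightarrow> G \<in> monic_irreducibles v \<Longrightarrow> 0 \<le> val G (\<theta> F)"
  by (intro val_nonneg root_nonneg monic_irreducibles_int)

lemma interaction_nonneg: "F \<in> factors_f \<Longrightarrow> 0 \<le> interaction F"
  unfolding interaction_def by (intro sum_nonneg val_factor_root_nonneg factor_irreducible) auto

lemma val_le_interaction:
  assumes "F \<in> factors_f" "G \<in> factors_f" "G \<noteq> F"
  shows "val G (\<theta> F) \<le> interaction F"
  unfolding interaction_def
  using assms finite_factors
  by (intro member_le_sum_ereal[of _ _ "\<lambda>G. val G (\<theta> F)"] val_factor_root_nonneg factor_irreducible) auto

lemma capped_f_eq: "capped (rts f) x r = (\<Sum>F\<in>factors_f. capped (rts F) x r)"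
  using rts_eq_sum_irreducible_factors[OF f_int f_monic f_separable] by (simp add: capped_sum)

lemma val_factor_symmetric:
  "F \<in> factors_f \<Longrightarrow> G \<in> factors_f \<Longrightarrow>
    ereal (real (degree F)) * val G (\<theta> F) = ereal (real (degree G)) * val F (\<theta> G)"
  by (intro val_reciprocity factor_irreducible root)

lemma degree_interaction:
  assumes "F \<in> factors_f"
  shows "ereal (real (degree F)) * interaction F =
    (\<Sum>G\<in>factors_f - {F}. ereal (real (degree F)) * val G (\<theta> F))"
  unfolding interaction_def
  using assms factor_irreducible val_factor_root_nonneg
  by (intro sum_ereal_right_distrib) auto

lemma delta_star_eq:
  "delta_star v w \<theta> f =
    1 / 2 * (\<Sum>F\<in>factors_f. ereal (real (degree F)) * bound F) +
    (\<Sum>F\<in>factors_f. ereal (real (degree F)) * interaction F)"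
proof -
  have "(\<Sum>(F, G)\<in>{(F, G). F \<in> factors_f \<and> G \<in> factors_f \<and> F \<noteq> G}. v (resultant F G)) =
      (\<Sum>(F, G)\<in>Sigma factors_f (\<lambda>F. factors_f - {F}). v (resultant F G))"
    by (intro sum.cong) auto
  also have "\<dots> = (\<Sum>F\<in>factors_f. \<Sum>G\<in>factors_f - {F}. v (resultant F G))"
    using finite_factors by (simp add: sum.Sigma)
  also have "\<dots> = (\<Sum>F\<in>factors_f. ereal (real (degree F)) * interaction F)"
    by (intro sum.cong refl, subst degree_interaction)
      (auto intro!: sum.cong val_resultant root simp: factor_irreducible)
  finally show ?thesis
    by (simp add: delta_star_def)
qed

text \<open>Each unordered pair is counted twice in the resultant sum, so by reciprocity the pairs
  involving \<open>F\<close> contribute twice its weighted interaction.\<close>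

lemma bound_interaction_le_delta_star:
  assumes P: "P \<in> factors_f" and F: "F \<in> factors_f"
  shows "bound P + 2 * (ereal (real (degree F)) * interaction F) \<le> delta_star v w \<theta> f"
proof -
  let ?d = "\<lambda>F. ereal (real (degree F))"
  \<comment> \<open>A linear \<open>P\<close> has bound zero by convention; otherwise its degree is
    at least two, which makes up for the factor one half.\<close>
  have "bound P \<le> 1 / 2 * (?d P * bound P)"
  proof (cases "degree P \<le> 1")
    case True
    then show ?thesis
      by (simp add: okutsu_bound_def)
  next
    case False
    then have "2 * r \<le> real (degree P) * r" if "0 \<le> r" for r
      using that by (intro mult_right_mono) auto
    then show ?thesis
      using False bound_nonneg[OF factor_irreducible[OF P]]
      by (cases "bound P") (auto simp: mult.commute divide_ereal_def)
  qed
  also have "\<dots> \<le> 1 / 2 * (\<Sum>F\<in>factors_f. ?d F * bound F)"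
    using P finite_factors bound_nonneg factor_irreducible
    by (intro ereal_mult_left_mono member_le_sum_ereal) auto
  finally have 1: "bound P \<le> 1 / 2 * (\<Sum>F\<in>factors_f. ?d F * bound F)" .
  have "2 * (?d F * interaction F) = ?d F * interaction F + ?d F * interaction F"
    using interaction_nonneg[OF F] by (cases "interaction F") auto
  also have "?d F * interaction F + ?d F * interaction F =
      ?d F * interaction F + (\<Sum>G\<in>factors_f - {F}. ?d G * val F (\<theta> G))"
    unfolding degree_interaction[OF F]
    using F by (intro arg_cong2[of _ _ _ _ plus] refl sum.cong val_factor_symmetric) auto
  also have "\<dots> \<le> ?d F * interaction F + (\<Sum>G\<in>factors_f - {F}. ?d G * interaction G)"
    using F by (intro add_left_mono sum_mono ereal_mult_left_mono val_le_interaction) auto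
  also have "\<dots> = (\<Sum>G\<in>factors_f. ?d G * interaction G)"
    using F finite_factors by (simp add: sum.remove)
  finally show ?thesis
    using 1 unfolding delta_star_eq by (intro add_mono)
qed

text \<open>As the degrees of the factors sum to \<open>degree f\<close>, division by it displays
  the threshold for irreducibility as a weighted mean of \<open>bound F + 2 * interaction F\<close>,
  which can be estimated factor by factor.\<close>

lemma two_delta_star_eq:
  "2 * delta_star v w \<theta> f =
    (\<Sum>F\<in>factors_f. ereal (real (degree F)) * (bound F + 2 * interaction F))"
proof -
  let ?d = "\<lambda>F. ereal (real (degree F))"
  have "(\<Sum>F\<in>factors_f. ?d F * (bound F + 2 * interaction F)) =
      (\<Sum>F\<in>factors_f. ?d F * bound F + 2 * (?d F * interaction F))"
  proof (rule sum.cong[OF refl])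
    fix F assume "F \<in> factors_f"
    then show "?d F * (bound F + 2 * interaction F) = ?d F * bound F + 2 * (?d F * interaction F)"
      using bound_nonneg[of F] interaction_nonneg[of F] factor_irreducible[of F]
        monic_irreducibles_degree_pos[of F]
      by (cases "bound F"; cases "interaction F") (auto simp: algebra_simps)
  qed
  also have "\<dots> = (\<Sum>F\<in>factors_f. ?d F * bound F) + 2 * (\<Sum>F\<in>factors_f. ?d F * interaction F)"
    unfolding sum.distrib
    by (subst sum_ereal_right_distrib) (auto simp: interaction_nonneg)
  also have "\<dots> = 2 * delta_star v w \<theta> f"
  proof -
    have "0 \<le> (\<Sum>F\<in>factors_f. ?d F * bound F)" "0 \<le> (\<Sum>F\<in>factors_f. ?d F * interaction F)"
      by (auto intro!: sum_nonneg simp: bound_nonneg interaction_nonneg factor_irreducible)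
    moreover have "1 / 2 = ereal (1 / 2)"
      by (simp add: one_ereal_def)
    ultimately show ?thesis
      unfolding delta_star_eq
      by (cases "\<Sum>F\<in>factors_f. ?d F * bound F"; cases "\<Sum>F\<in>factors_f. ?d F * interaction F") auto
  qed
  finally show ?thesis ..
qed

section \<open>Stability of irreducibility\<close>

lemma irreducible_close:
  assumes f: "f \<in> monic_irreducibles v"
    and g: "g \<in> int_polys v" "lead_coeff g = 1" "degree g = degree f"
    and cong: "\<And>i. ereal s \<le> v (coeff (g - f) i)"
    and less: "2 * delta_star v w \<theta> f < ereal (real (degree f)) * ereal s"
  shows "g \<in> monic_irreducibles v"
proof -
  have d: "degree f > 0"
    using f by (rule monic_irreducibles_degree_pos)
  have "F = f" if "F \<in> factors_f" for F
  proof (rule rts_eqI[OF factor_irreducible[OF that] f root[OF factor_irreducible[OF that]]])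
    show "\<theta> F \<in># rts f"
      using factor_root that .
  qed
  then have factors: "factors_f = {f}"
    using f f_int f_monic by (auto simp: irreducible_factors_iff)
  \<comment> \<open>With a single factor the interaction is an empty sum, so the hypothesis amounts
    to \<open>bound f < s\<close>.\<close>
  then have "2 * delta_star v w \<theta> f = ereal (real (degree f)) * bound f"
    unfolding two_delta_star_eq by (simp add: interaction_def)
  then have bound: "bound f < ereal s"
    using less d by (cases "bound f") auto
  obtain y where y: "y \<in># rts g"
    using g d size_rts[of g] by (metis degree_0 less_irrefl multiset_nonemptyE size_empty)
  obtain H where H: "H \<in> irreducible_factors v g" "y \<in># rts H"
    using irreducible_factor_of_root[OF g(1,2) y] .
  have "0 \<le> w y"
    using g y rts_nonneg by blast
  then have "ereal s \<le> val f y"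
    using val_root_of_congruent(1)[OF cong] y g by (auto simp: in_rts_iff monic_nonzero)
  then have "degree f \<le> degree H"
    using H f g bound root[OF f]
    by (intro degree_le_of_okutsu_bound_less[of f "\<theta> f" H y]) (auto simp: irreducible_factors_iff)
  then have "H = g"
    using H g by (intro monic_eqI_dvd) (auto simp: irreducible_factors_iff monic_irreducibles_monic)
  then show ?thesis
    using H g by (simp add: irreducible_factors_iff)
qed

lemma irreducible_of_irreducible_close:
  assumes g: "g \<in> monic_irreducibles v" "degree g = degree f"
    and cong: "\<And>i. ereal s \<le> v (coeff (g - f) i)" "0 \<le> s"
    and less: "2 * delta_star v w \<theta> f < ereal (real (degree f)) * ereal s"
  shows "f \<in> monic_irreducibles v"
proof (rule ccontr)
  assume red: "f \<notin> monic_irreducibles v"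
  define d where "d = degree f"
  have d: "d > 0"
    using g monic_irreducibles_degree_pos[of g] by (simp add: d_def)
  note g_monic = monic_irreducibles_monic[OF g(1)]
  define y where "y = \<theta> g"
  have y: "y \<in># rts g" "0 \<le> w y"
    using root root_nonneg g by (auto simp: y_def)
  \<comment> \<open>\<open>g\<close> has value at least \<open>s\<close> at every root of
    \<open>f\<close>; reciprocity with the irreducible \<open>g\<close> moves this to the value of
    \<open>F\<close> at \<open>y\<close>.\<close>
  have ge: "ereal (real (degree F) * s) \<le> ereal (real d) * val F y" if F: "F \<in> factors_f" for F
  proof -
    have "poly (ac_poly f) (\<theta> F) = 0"
      using factor_root[OF F] monic_nonzero[OF f_monic] by (simp add: in_rts_iff)
    then have "ereal s \<le> val g (\<theta> F)"
      using val_root_of_congruent(2)[OF cong(1)] root_nonneg[OF factor_irreducible[OF F]] by blast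
    then have "ereal (real (degree F)) * ereal s \<le> ereal (real (degree F)) * val g (\<theta> F)"
      by (intro ereal_mult_left_mono) auto
    also have "\<dots> = ereal (real d) * val F y"
      using val_reciprocity[of F g "\<theta> F" y] F g y root factor_irreducible by (simp add: d_def)
    finally show ?thesis
      by simp
  qed
  have "\<exists>x\<in>#rts F. \<forall>x'\<in>#rts F. w (y - x') \<le> w (y - x)" if "F \<in> factors_f" for F
    by (rule nearest_exists[OF root[OF factor_irreducible[OF that]], of y]) blast
  then obtain near where near: "\<And>F. F \<in> factors_f \<Longrightarrow> near F \<in># rts F"
    "\<And>F x. F \<in> factors_f \<Longrightarrow> x \<in># rts F \<Longrightarrow> w (y - x) \<le> w (y - near F)"
    by metis
  \<comment> \<open>If the root of \<open>F\<close> nearest to \<open>y\<close> is at least as near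
    as all roots of \<open>G\<close>, it may replace \<open>y\<close> as the argument of
    \<open>G\<close>.\<close>
  have half: "ereal (real (degree G) * s) \<le> ereal (real d) * val G (\<theta> F)"
    if F: "F \<in> factors_f" and G: "G \<in> factors_f" and le: "w (y - near G) \<le> w (y - near F)" for F G
  proof -
    have "val G y \<le> val G (near F)"
      using monic_irreducibles_monic[OF factor_irreducible[OF G]]
    proof (rule val_le_of_closer)
      show "w (y - x) \<le> w (y - near F)" if "x \<in># rts G" for x
        using near(2)[OF G that] le by order
    qed
    also have "\<dots> = val G (\<theta> F)"
      using near(1)[OF F] root factor_irreducible[OF F] by (intro val_conjugate[of F])
    finally have "ereal (real d) * val G y \<le> ereal (real d) * val G (\<theta> F)"
      by (intro ereal_mult_left_mono) auto
    then show ?thesis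
      using ge[OF G] by order
  qed
  have pair: "ereal (real (degree G) * s / real d) \<le> val G (\<theta> F)"
    if F: "F \<in> factors_f" and G: "G \<in> factors_f" for F G
  proof (cases "w (y - near G) \<le> w (y - near F)")
    case True
    then show ?thesis
      using half[OF F G] d by (cases "val G (\<theta> F)") (auto simp: field_simps)
  next
    \<comment> \<open>Now \<open>G\<close> has the nearer root: the estimate holds for the reversed
      pair, and reciprocity between \<open>F\<close> and \<open>G\<close> turns it round.\<close>
    case False
    then have "ereal (real (degree F) * s) \<le> ereal (real d) * val F (\<theta> G)"
      using half[OF G F] by simp
    moreover note val_factor_symmetric[OF F G]
    moreover have "degree F > 0" "degree G > 0"
      using F G factor_irreducible monic_irreducibles_degree_pos by auto
    moreover have arith: "s * b \<le> t * real d" if "s * a \<le> r * real d" "t * a = r * b" "0 < a" "0 < b"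
      for a b r t :: real
    proof -
      have "(s * a) * b \<le> (r * real d) * b"
        using that by (intro mult_right_mono) auto
      also have "\<dots> = (t * a) * real d"
        using that by simp
      finally have "(s * b) * a \<le> (t * real d) * a"
        by (simp only: mult_ac)
      then show ?thesis
        using \<open>0 < a\<close> by simp
    qed
    ultimately show ?thesis
      using d arith[of "real (degree F)" "real_of_ereal (val F (\<theta> G))"
          "real_of_ereal (val G (\<theta> F))" "real (degree G)"]
      by (cases "val F (\<theta> G)"; cases "val G (\<theta> F)") (auto simp: field_simps)
  qed
  have sum_degree: "d = (\<Sum>F\<in>factors_f. degree F)"
    unfolding d_def by (rule degree_eq_sum_irreducible_factors[OF f_int f_monic f_separable])
  have main: "ereal s \<le> bound F + 2 * interaction F" if F: "F \<in> factors_f" for F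
  proof -
    have rest: "real d - real (degree F) = (\<Sum>G\<in>factors_f - {F}. real (degree G))"
      using sum_degree F finite_factors by (simp add: sum.remove)
    have "ereal ((real d - real (degree F)) * s / real d) =
        (\<Sum>G\<in>factors_f - {F}. ereal (real (degree G) * s / real d))"
      by (simp add: rest sum_distrib_right sum_divide_distrib)
    also have "\<dots> \<le> interaction F"
      unfolding interaction_def using F by (intro sum_mono pair) auto
    finally have int: "ereal ((real d - real (degree F)) * s / real d) \<le> interaction F" .
    have "F \<noteq> f"
      using red F factor_irreducible by auto
    then have "degree F < d"
      using F monic_eqI_dvd[of F f] f_monic f_int factor_irreducible[OF F]
      by (force simp: d_def irreducible_factors_iff monic_irreducibles_monic)
    then have "factors_f - {F} \<noteq> {}"
      using rest by (intro notI) simp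
    then obtain G where G: "G \<in> factors_f" "G \<noteq> F"
      by auto
    have G_pos: "degree G > 0"
      using G factor_irreducible monic_irreducibles_degree_pos by auto
    \<comment> \<open>If \<open>G\<close> has smaller degree than \<open>F\<close>, it competes in
      \<open>bound F\<close> and supplies the share \<open>degree F / d\<close> of \<open>s\<close>
      left open by the interaction. Otherwise \<open>degree F\<close> is at most half of
      \<open>d\<close>, and twice the interaction suffices.\<close>
    show ?thesis
    proof (cases "degree G < degree F")
      case True
      have "ereal (real (degree F) * (real (degree G) * s / real d)) \<le>
          ereal (real (degree F)) * val G (\<theta> F)"
        using ereal_mult_left_mono[OF pair[OF F G(1)], of "ereal (real (degree F))"] by simp
      also have "\<dots> \<le> ereal (real (degree G)) * bound F"
        using G True by (intro val_le_okutsu_bound)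
          (auto simp: factor_irreducible monic_irreducibles_int monic_irreducibles_monic)
      finally have "ereal (real (degree G)) * ereal (real (degree F) * s / real d) \<le>
          ereal (real (degree G)) * bound F"
        by (simp add: mult_ac)
      then have "ereal (real (degree F) * s / real d) \<le> bound F"
        using G_pos by (subst (asm) ereal_mult_le_mult_iff) auto
      moreover have "s \<le> real (degree F) * s / real d + 2 * ((real d - real (degree F)) * s / real d)"
        using \<open>degree F < d\<close> cong(2) d by (simp add: field_simps) (simp add: mult_left_mono)
      ultimately show ?thesis
        using int by (cases "bound F"; cases "interaction F") auto
    next
      case False
      have "real (degree G) \<le> (\<Sum>G\<in>factors_f - {F}. real (degree G))"
        using G finite_factors by (intro member_le_sum) auto
      then have "2 * real (degree F) \<le> real d"
        using False rest by simp
      then have "2 * real (degree F) * s \<le> real d * s"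
        using cong(2) by (rule mult_right_mono)
      then have "s \<le> 2 * ((real d - real (degree F)) * s / real d)"
        using d by (simp add: field_simps)
      moreover have "0 \<le> bound F"
        using F bound_nonneg factor_irreducible by auto
      ultimately show ?thesis
        using int by (cases "bound F"; cases "interaction F") auto
    qed
  qed
  have "ereal (real d) * ereal s = (\<Sum>F\<in>factors_f. ereal (real (degree F) * s))"
    by (simp add: sum_degree sum_distrib_right)
  also have "\<dots> \<le> (\<Sum>F\<in>factors_f. ereal (real (degree F)) * (bound F + 2 * interaction F))"
    using main by (intro sum_mono) (metis ereal_mult_left_mono ereal_less_eq(5) of_nat_0_le_iff times_ereal.simps(1))
  also have "\<dots> = 2 * delta_star v w \<theta> f"
    by (rule two_delta_star_eq[symmetric])
  finally show False
    using less by (simp add: d_def)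
qed

end

section \<open>Matching the factors of two close polynomials\<close>

locale close_factorisation = separable_factorisation v w \<theta> f
  for v :: "'k::field \<Rightarrow> ereal" and w \<theta> f +
  fixes g :: "'k poly" and s :: real
  assumes g_int: "g \<in> int_polys v" and g_monic: "lead_coeff g = 1"
    and g_separable: "separable_poly g" and degree_g: "degree g = degree f"
    and congruent: "ereal s \<le> v (coeff (g - f) i)"
    and delta_star_less: "delta_star v w \<theta> f < ereal s"
begin

sublocale G: separable_factorisation v w \<theta> g
  by unfold_locales (use root g_int g_monic g_separable in auto)

abbreviation factors_g where "factors_g \<equiv> irreducible_factors v g"

section \<open>Numerical consequences of \<open>delta_star v w \<theta> f < s\<close>\<close>

lemma bound_interaction_less:
  assumes "P \<in> factors_f" "F \<in> factors_f"
  shows "bound P + 2 * (ereal (real (degree F)) * interaction F) < ereal s"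
  using bound_interaction_le_delta_star[OF assms] delta_star_less by order

lemma interaction_le_degree_mult:
  assumes "F \<in> factors_f"
  shows "interaction F \<le> ereal (real (degree F)) * interaction F"
  using ereal_mult_right_mono[of 1 "ereal (real (degree F))" "interaction F"] assms
    interaction_nonneg[OF assms] monic_irreducibles_degree_pos[OF factor_irreducible[OF assms]]
  by simp

lemma bound_add_interaction_less:
  assumes P: "P \<in> factors_f" and F: "F \<in> factors_f"
  shows "bound P + interaction F + interaction F < ereal s"
proof -
  have "bound P + interaction F + interaction F = bound P + 2 * interaction F"
    using interaction_nonneg[OF F] by (cases "interaction F"; cases "bound P") auto
  also have "\<dots> \<le> bound P + 2 * (ereal (real (degree F)) * interaction F)"
    using interaction_le_degree_mult[OF F] by (intro add_left_mono ereal_mult_left_mono) auto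
  also have "\<dots> < ereal s"
    by (rule bound_interaction_less[OF P F])
  finally show ?thesis .
qed

lemma bound_less_of_close:
  assumes F: "F \<in> factors_f" and y: "ereal s \<le> val F y + interaction F"
  shows "bound F < val F y"
proof (rule ccontr)
  assume "\<not> bound F < val F y"
  then have "val F y + interaction F \<le> bound F + interaction F"
    by (intro add_right_mono) auto
  also have "\<dots> \<le> bound F + interaction F + interaction F"
    using interaction_nonneg[OF F] by (simp add: add_increasing2)
  finally show False
    using y bound_add_interaction_less[OF F F] by order
qed

lemma degree_le_of_close:
  assumes F: "F \<in> factors_f" and y: "ereal s \<le> val F y + interaction F"
    and H: "H \<in> monic_irreducibles v" "y \<in># rts H"
  shows "degree F \<le> degree H"
  using degree_le_of_okutsu_bound_less[OF factor_irreducible[OF F] root[OF factor_irreducible[OF F]] H]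
    bound_less_of_close[OF F y] .

text \<open>Both summands are at most \<open>degree F * interaction F\<close>, the first by
  reciprocity with \<open>Q\<close>. Hence roots of other factors of \<open>f\<close> stay below the
  threshold used in \<open>matched\<close>.\<close>

lemma val_other_root_less:
  assumes F: "F \<in> factors_f" and Q: "Q \<in> factors_f" "Q \<noteq> F"
  shows "val F (\<theta> Q) + interaction F < ereal s"
proof -
  let ?d = "\<lambda>F. ereal (real (degree F))"
  have "0 \<le> val F (\<theta> Q)"
    using F Q by (intro val_factor_root_nonneg factor_irreducible)
  then have "val F (\<theta> Q) \<le> ?d Q * val F (\<theta> Q)"
    using ereal_mult_right_mono[of 1 "?d Q" "val F (\<theta> Q)"]
      monic_irreducibles_degree_pos[OF factor_irreducible[OF Q(1)]] by simp
  also have "\<dots> = ?d F * val Q (\<theta> F)"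
    using val_factor_symmetric[OF Q(1) F] .
  also have "\<dots> \<le> ?d F * interaction F"
    using val_le_interaction[OF F Q] by (intro ereal_mult_left_mono) auto
  finally have "val F (\<theta> Q) + interaction F \<le> ?d F * interaction F + ?d F * interaction F"
    by (intro add_mono interaction_le_degree_mult[OF F])
  also have "\<dots> = 2 * (?d F * interaction F)"
    using interaction_nonneg[OF F] by (cases "interaction F") auto
  also have "\<dots> \<le> bound F + 2 * (?d F * interaction F)"
    using bound_nonneg[OF factor_irreducible[OF F]] by (simp add: add_increasing)
  also have "\<dots> < ereal s"
    by (rule bound_interaction_less[OF F F])
  finally show ?thesis .
qed

lemma val_other_root_add_bound_less:
  assumes P: "P \<in> factors_f" and Q: "Q \<in> factors_f" "Q \<noteq> P"
  shows "val P (\<theta> Q) + bound P + interaction Q < ereal s"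
proof -
  have "val P (\<theta> Q) + bound P + interaction Q \<le> interaction Q + bound P + interaction Q"
    using val_le_interaction[OF Q(1) P] Q(2) by (intro add_right_mono) auto
  also have "\<dots> = bound P + interaction Q + interaction Q"
    by (simp add: add_ac)
  finally show ?thesis
    using bound_add_interaction_less[OF P Q(1)] by order
qed

text \<open>For a factor \<open>H\<close> of \<open>g\<close>, \<open>f\<close> has value at least
  \<open>s\<close> at \<open>\<theta> H\<close>; here \<open>F\<close> is asked to account for all
  of \<open>s\<close> except what the other factors contribute at \<open>\<theta> F\<close>. The
  additive form avoids differences of possibly infinite values.\<close>

definition matched :: "'k poly \<Rightarrow> 'k poly \<Rightarrow> bool" where
  "matched F H \<longleftrightarrow> ereal s \<le> val F (\<theta> H) + interaction F"

text \<open>Say a root of \<open>F\<close> is at least as near to \<open>y\<close> as all roots of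
  \<open>G\<close>. The value of \<open>G\<close> there is at least its value at \<open>y\<close>,
  so \<open>G\<close> would reach the threshold at a root of \<open>F\<close>, against
  \<open>val_other_root_less\<close>.\<close>

lemma matched_unique:
  assumes F: "F \<in> factors_f" and G: "G \<in> factors_f" and H: "H \<in> monic_irreducibles v"
    and matched: "matched F H" "matched G H"
  shows "F = G"
proof (rule ccontr)
  assume "F \<noteq> G"
  define y where "y = \<theta> H"
  have no: False
    if F: "F \<in> factors_f" and G: "G \<in> factors_f" and "F \<noteq> G" and "matched G H"
      and a: "a \<in># rts F" and le: "\<And>b. b \<in># rts G \<Longrightarrow> w (y - b) \<le> w (y - a)" for F G a
  proof -
    have "val G y \<le> val G a"
      using monic_irreducibles_monic[OF factor_irreducible[OF G]] le by (rule val_le_of_closer)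
    also have "\<dots> = val G (\<theta> F)"
      using a F by (intro val_conjugate[of F] factor_irreducible root)
    finally have "val G y + interaction G \<le> val G (\<theta> F) + interaction G"
      by (rule add_right_mono)
    then show False
      using val_other_root_less[OF G F] that by (auto simp: matched_def y_def)
  qed
  obtain a where a: "a \<in># rts F" "\<And>x. x \<in># rts F \<Longrightarrow> w (y - x) \<le> w (y - a)"
    by (rule nearest_exists[OF root[OF factor_irreducible[OF F]], of y]) (rule that)
  obtain b where b: "b \<in># rts G" "\<And>x. x \<in># rts G \<Longrightarrow> w (y - x) \<le> w (y - b)"
    by (rule nearest_exists[OF root[OF factor_irreducible[OF G]], of y]) (rule that)
  show False
  proof (cases "w (y - b) \<le> w (y - a)")
    case True
    show False
    proof (rule no[OF F G \<open>F \<noteq> G\<close> matched(2) a(1)])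
      show "w (y - x) \<le> w (y - a)" if "x \<in># rts G" for x
        using b(2)[OF that] True by order
    qed
  next
    case False
    show False
    proof (rule no[OF G F \<open>F \<noteq> G\<close>[symmetric] matched(1) b(1)])
      show "w (y - x) \<le> w (y - b)" if "x \<in># rts F" for x
        using a(2)[OF that] False by order
    qed
  qed
qed

text \<open>The partner is the factor of \<open>g\<close> through the root \<open>y\<close> of
  \<open>g\<close> nearest to \<open>\<theta> F\<close>. On the ball around
  \<open>\<theta> F\<close> that just reaches \<open>y\<close>, the Gauss valuation of
  \<open>g\<close> is still its value at the centre, hence at least \<open>s\<close>, and the
  congruence passes this to \<open>f\<close>.\<close>

lemma matched_exists:
  assumes F: "F \<in> factors_f"
  obtains H where "H \<in> factors_g" "matched F H"
proof -
  define x where "x = \<theta> F"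
  have x: "0 \<le> w x"
    unfolding x_def by (rule root_nonneg[OF factor_irreducible[OF F]])
  have "rts g \<noteq> {#}"
  proof
    assume "rts g = {#}"
    then have "degree f = 0"
      using size_rts[of g] monic_nonzero[OF g_monic] degree_g by simp
    then have "rts f = {#}"
      using size_rts[of f] monic_nonzero[OF f_monic] by simp
    then show False
      using factor_root[OF F] by simp
  qed
  then obtain y0 where "y0 \<in># rts g"
    by auto
  obtain y where y: "y \<in># rts g" "\<And>y'. y' \<in># rts g \<Longrightarrow> w (x - y') \<le> w (x - y)"
    using \<open>y0 \<in># rts g\<close> by (rule nearest_exists[of y0 "rts g" x]) (rule that)
  have y_nonneg: "0 \<le> w y"
    using rts_nonneg[OF g_int g_monic y(1)] .
  have "ereal s \<le> val g x"
    using val_root_of_congruent(2)[OF congruent x] factor_root[OF F] monic_nonzero[OF f_monic]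
    by (simp add: in_rts_iff x_def)
  also have "\<dots> = capped (rts g) x (w (x - y))"
    using capped_eq_val[OF g_monic y(2)] by simp
  finally have "ereal s \<le> capped (rts f) x (w (x - y))"
    using x y_nonneg
    by (intro capped_ge_of_congruent[OF f_monic g_monic congruent]) (auto intro: val_diff_geI)
  also have "\<dots> = capped (rts F) x (w (x - y)) + (\<Sum>G\<in>factors_f - {F}. capped (rts G) x (w (x - y)))"
    unfolding capped_f_eq using F finite_factors by (simp add: sum.remove)
  \<comment> \<open>On the same ball \<open>F\<close> is evaluated at \<open>y\<close>, but the
    other factors at the centre, where they make up the interaction.\<close>
  also have "\<dots> \<le> val F y + interaction F"
    unfolding interaction_def x_def
    by (intro add_mono sum_mono capped_le_val_close capped_le_val)
      (auto intro: monic_irreducibles_monic factor_irreducible F)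
  finally have close: "ereal s \<le> val F y + interaction F" .
  obtain H where H: "H \<in> factors_g" "y \<in># rts H"
    using irreducible_factor_of_root[OF g_int g_monic y(1)] .
  then have "val F y = val F (\<theta> H)"
    by (intro val_conjugate[of H] root G.factor_irreducible)
  then show thesis
    using that[OF H(1)] close by (simp add: matched_def)
qed

text \<open>Uniqueness makes the choice of partners injective, and a partner has at least the same
  degree. Both families of degrees sum to \<open>degree f\<close>, so no factor of \<open>g\<close>
  is left over and the inequalities are equalities.\<close>

lemma matching:
  obtains m where "bij_betw m factors_f factors_g" "\<And>F. F \<in> factors_f \<Longrightarrow> matched F (m F)"
    "\<And>F. F \<in> factors_f \<Longrightarrow> degree (m F) = degree F"
proof -
  have "\<exists>H. H \<in> factors_g \<and> matched F H" if "F \<in> factors_f" for F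
    using matched_exists[OF that] by blast
  then obtain m where m: "\<And>F. F \<in> factors_f \<Longrightarrow> m F \<in> factors_g"
    "\<And>F. F \<in> factors_f \<Longrightarrow> matched F (m F)"
    by metis
  have inj: "inj_on m factors_f"
    using m matched_unique G.factor_irreducible by (intro inj_onI) metis
  have le: "degree F \<le> degree (m F)" if "F \<in> factors_f" for F
    using degree_le_of_close[OF that _ G.factor_irreducible[OF m(1)[OF that]] root[OF G.factor_irreducible[OF m(1)[OF that]]]]
      m(2)[OF that] by (simp add: matched_def)
  have sub: "m ` factors_f \<subseteq> factors_g"
    using m by auto
  have sum_f: "degree f = (\<Sum>F\<in>factors_f. degree F)"
    by (rule degree_eq_sum_irreducible_factors[OF f_int f_monic f_separable])
  have sum_g: "degree f = (\<Sum>H\<in>factors_g. degree H)"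
    using degree_eq_sum_irreducible_factors[OF g_int g_monic g_separable] degree_g by simp
  have image: "(\<Sum>H\<in>m ` factors_f. degree H) = (\<Sum>F\<in>factors_f. degree (m F))"
    using sum.reindex[OF inj, of degree] by simp
  have split: "(\<Sum>H\<in>factors_g. degree H) =
      (\<Sum>H\<in>factors_g - m ` factors_f. degree H) + (\<Sum>H\<in>m ` factors_f. degree H)"
    using sum.subset_diff[OF sub G.finite_factors] .
  have mono: "(\<Sum>F\<in>factors_f. degree F) \<le> (\<Sum>F\<in>factors_f. degree (m F))"
    using le by (rule sum_mono)
  have eq: "(\<Sum>F\<in>factors_f. degree F) = (\<Sum>F\<in>factors_f. degree (m F))"
    and zero: "(\<Sum>H\<in>factors_g - m ` factors_f. degree H) = 0"
    using sum_f sum_g image split mono by linarith+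
  have "m ` factors_f = factors_g"
    using zero sub G.finite_factors monic_irreducibles_degree_pos G.factor_irreducible
    by (auto simp: sum_eq_0_iff) (metis DiffI less_irrefl)
  moreover have "degree F = degree (m F)" if "F \<in> factors_f" for F
    using sum_mono_inv[OF eq le that finite_factors] .
  ultimately show thesis
    using that[of m] inj m(2) by (simp add: bij_betw_def)
qed

text \<open>For matched factors choose roots at minimal distance. If a monic polynomial takes different
  values at these two roots, one of its roots lies in the smallest ball around them.\<close>

lemma val_transfer:
  assumes F: "F \<in> factors_f" and H: "H \<in> monic_irreducibles v" and matched: "matched F H"
    and degree: "degree H = degree F" and h: "h \<in> int_polys v" "lead_coeff h = 1"
  obtains (eq) "val h (\<theta> F) = val h (\<theta> H)"
    | (diff) z \<psi> where "\<psi> \<in> monic_irreducibles v" "z \<in># rts \<psi>" "\<psi> dvd h" "degree F \<le> degree \<psi>"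
      "ereal s \<le> val F z + interaction F" "ereal s \<le> val H z + interaction F"
      "\<And>G. G \<in> factors_f \<Longrightarrow> G \<noteq> F \<Longrightarrow> val G z = val G (\<theta> F)"
proof -
  note F_irr = factor_irreducible[OF F]
  note F_monic = monic_irreducibles_monic[OF F_irr] and H_monic = monic_irreducibles_monic[OF H]
  have "Max ((\<lambda>(a, b). w (a - b)) ` (set_mset (rts F) \<times> set_mset (rts H))) \<in>
      (\<lambda>(a, b). w (a - b)) ` (set_mset (rts F) \<times> set_mset (rts H))"
    using root[OF F_irr] root[OF H] by (intro Max_in) auto
  then obtain a b where ab: "a \<in># rts F" "b \<in># rts H"
    and "w (a - b) = Max ((\<lambda>(a, b). w (a - b)) ` (set_mset (rts F) \<times> set_mset (rts H)))"
    by auto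
  then have max: "w (a' - b') \<le> w (a - b)" if "a' \<in># rts F" "b' \<in># rts H" for a' b'
    using that by (auto intro!: Max_ge)
  define r where "r = w (a - b)"
  have r: "r = w (b - a)"
    by (simp add: r_def val_minus_commute)
  \<comment> \<open>\<open>a\<close> and \<open>b\<close> are a nearest pair, so truncation at
    \<open>r\<close> changes neither \<open>F\<close> at \<open>b\<close> nor \<open>H\<close> at
    \<open>a\<close>.\<close>
  have Fb: "capped (rts F) b r = val F b"
    using F_monic max ab by (intro capped_eq_val) (auto simp: r_def val_minus_commute[of b])
  have Ha: "capped (rts H) a r = val H a"
    using H_monic max ab by (intro capped_eq_val) (auto simp: r_def)
  have "ereal (real (degree F)) * val H a = ereal (real (degree F)) * val F b"
    using val_reciprocity[OF F_irr H ab] degree by simp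
  then have HF: "val H a = val F b"
    using monic_irreducibles_degree_pos[OF F_irr] by (simp add: ereal_mult_cancel_left)
  have close: "ereal s \<le> val F b + interaction F"
    using matched val_conjugate[OF H ab(2) root[OF H]] by (simp add: matched_def)
  \<comment> \<open>By way of \<open>capped\<close>, the values of \<open>F\<close> and
    \<open>H\<close> anywhere in the ball are at least \<open>val F b\<close>, so they still reach
    the threshold.\<close>
  have ball: "ereal s \<le> val F z + interaction F" "ereal s \<le> val H z + interaction F"
    if "r \<le> w (a - z)" for z
  proof -
    have "val F b \<le> val F z"
      using capped_le_val_close[OF F_monic, of r b z] Fb close_trans[of r b a z] that r by simp
    moreover have "val F b \<le> val H z"
      using capped_le_val_close[OF H_monic that] Ha HF by simp
    ultimately show "ereal s \<le> val F z + interaction F" "ereal s \<le> val H z + interaction F"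
      using close by (meson add_right_mono order_trans)+
  qed
  \<comment> \<open>Roots of other factors lie outside the ball, since inside it \<open>F\<close>
    would be larger than \<open>val_other_root_less\<close> allows.\<close>
  have far: "w (a - c) < r" if G: "G \<in> factors_f" "G \<noteq> F" and c: "c \<in># rts G" for G c
  proof (rule ccontr)
    assume "\<not> w (a - c) < r"
    then have "ereal s \<le> val F c + interaction F"
      by (intro ball) auto
    also have "val F c = val F (\<theta> G)"
      using c G by (intro val_conjugate[of G] factor_irreducible root)
    finally show False
      using val_other_root_less[OF F G] by order
  qed
  show thesis
  proof (cases "\<exists>z\<in>#rts h. r \<le> w (a - z)")
    case False
    then have "w (b - z) = w (a - z)" if "z \<in># rts h" for z
      using that by (intro val_diff_eq_of_closer) (auto simp: r_def not_le)
    then have "val h b = val h a"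
      unfolding val_eq_sum_rts[OF h(2)] by (intro arg_cong[of _ _ sum_mset] image_mset_cong)
    then show thesis
      using eq val_conjugate[OF F_irr ab(1) root[OF F_irr]] val_conjugate[OF H ab(2) root[OF H]]
      by simp
  next
    case True
    then obtain z where z: "z \<in># rts h" "r \<le> w (a - z)"
      by auto
    obtain \<psi> where \<psi>: "\<psi> \<in> irreducible_factors v h" "z \<in># rts \<psi>"
      using irreducible_factor_of_root[OF h z(1)] .
    then have \<psi>': "\<psi> \<in> monic_irreducibles v" "\<psi> dvd h"
      using h by (auto simp: irreducible_factors_iff)
    have "val G z = val G (\<theta> F)" if G: "G \<in> factors_f" "G \<noteq> F" for G
    proof -
      have "w (z - c) = w (a - c)" if "c \<in># rts G" for c
        using far[OF G that] z(2) by (intro val_diff_eq_of_closer) order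
      then have "val G z = val G a"
        unfolding val_eq_sum_rts[OF monic_irreducibles_monic[OF factor_irreducible[OF G(1)]]]
        by (intro arg_cong[of _ _ sum_mset] image_mset_cong)
      then show ?thesis
        using val_conjugate[OF F_irr ab(1) root[OF F_irr]] by simp
    qed
    then show thesis
      using diff[OF \<psi>'(1) \<psi>(2) \<psi>'(2) degree_le_of_close[OF F ball(1)[OF z(2)] \<psi>'(1) \<psi>(2)]
          ball[OF z(2)]] by blast
  qed
qed

section \<open>Transfer of Okutsu frames and OM-factorisations\<close>

lemma val_transfer_small_degree:
  assumes "F \<in> factors_f" "H \<in> monic_irreducibles v" "matched F H" "degree H = degree F"
    and h: "h \<in> int_polys v" "lead_coeff h = 1" "degree h < degree F"
  shows "val h (\<theta> F) = val h (\<theta> H)"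
  using assms(1-4) h(1,2)
proof (cases rule: val_transfer)
  case (diff z \<psi>)
  then have "degree \<psi> \<le> degree h"
    using h monic_nonzero[OF h(2)] by (intro dvd_imp_degree_le) auto
  then show ?thesis
    using diff h by simp
qed

lemma val_eq_of_irreducible_same_degree:
  assumes "F \<in> factors_f" "\<psi> \<in> monic_irreducibles v" "z \<in># rts \<psi>" "degree \<psi> = degree F"
  shows "val \<psi> (\<theta> F) = val F z"
  using val_reciprocity[OF factor_irreducible[OF assms(1)] assms(2) root[OF factor_irreducible[OF assms(1)]] assms(3)]
    monic_irreducibles_degree_pos[OF assms(2)] assms(4)
  by (simp add: ereal_mult_cancel_left)

text \<open>In the second alternative of \<open>val_transfer\<close> the factor has full degree, so
  \<open>h\<close> itself is irreducible and reciprocity with \<open>F\<close> evaluates it.\<close>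

lemma val_transfer_same_degree:
  assumes F: "F \<in> factors_f" and H: "H \<in> monic_irreducibles v" "matched F H" "degree H = degree F"
    and h: "h \<in> int_polys v" "lead_coeff h = 1" "degree h = degree F"
  shows "val h (\<theta> F) = val h (\<theta> H) \<or> bound F < val h (\<theta> F)"
  using F H h(1,2)
proof (cases rule: val_transfer)
  case (diff z \<psi>)
  have "\<psi> = h"
    using diff h by (intro monic_eqI_dvd) (auto simp: monic_irreducibles_monic)
  then have "val h (\<theta> F) = val F z"
    using val_eq_of_irreducible_same_degree[OF F] diff h by simp
  then show ?thesis
    using bound_less_of_close[OF F diff(5)] by simp
qed simp

lemma nth_degree_mono:
  fixes \<phi>s :: "'b::zero poly list"
  assumes "\<And>i. Suc i < length \<phi>s \<Longrightarrow> degree (\<phi>s ! i) < degree (\<phi>s ! Suc i)"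
    and "i \<le> j" "j < length \<phi>s"
  shows "degree (\<phi>s ! i) \<le> degree (\<phi>s ! j)"
  using assms(2,3)
proof (induction j rule: dec_induct)
  case (step j)
  then show ?case
    using assms(1)[of j] by simp
qed simp

text \<open>The competitors and all members before the last have degree below
  \<open>degree F\<close>, where the values at the two roots agree. Only the last member can change
  its value, and its value at \<open>\<theta> F\<close> then exceeds \<open>bound F\<close>.\<close>

lemma okutsu_frame_transfer:
  assumes F: "F \<in> factors_f" and H: "H \<in> monic_irreducibles v" "matched F H" "degree H = degree F"
    and frame: "okutsu_frame v w H (\<theta> H) \<phi>s"
  shows "okutsu_frame v w F (\<theta> F) \<phi>s"
proof -
  have ne: "\<phi>s \<noteq> []" and mem: "\<And>\<phi>. \<phi> \<in> set \<phi>s \<Longrightarrow> \<phi> \<in> int_polys v \<and> lead_coeff \<phi> = 1"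
    and hd: "1 \<le> degree (hd \<phi>s)" and last: "degree (last \<phi>s) = degree F"
    and step: "\<And>i. Suc i < length \<phi>s \<Longrightarrow> degree (\<phi>s ! i) dvd degree (\<phi>s ! Suc i) \<and>
        degree (\<phi>s ! i) < degree (\<phi>s ! Suc i)"
    and slopes: "\<And>i h. Suc i < length \<phi>s \<Longrightarrow> h \<in> int_polys v \<Longrightarrow> lead_coeff h = 1 \<Longrightarrow> 0 < degree h \<Longrightarrow>
        degree h < degree (\<phi>s ! Suc i) \<Longrightarrow>
        slope w h (\<theta> H) \<le> slope w (\<phi>s ! i) (\<theta> H) \<and>
        slope w (\<phi>s ! i) (\<theta> H) < slope w (\<phi>s ! Suc i) (\<theta> H)"
    using frame H(3) unfolding okutsu_frame_def by auto
  have slope_eq: "slope w h (\<theta> F) = slope w h (\<theta> H)"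
    if "h \<in> int_polys v" "lead_coeff h = 1" "degree h < degree F" for h
    using val_transfer_small_degree[OF F H that] by (simp add: slope_def)
  have "slope w h (\<theta> F) \<le> slope w (\<phi>s ! i) (\<theta> F) \<and>
      slope w (\<phi>s ! i) (\<theta> F) < slope w (\<phi>s ! Suc i) (\<theta> F)"
    if i: "Suc i < length \<phi>s" and h: "h \<in> int_polys v" "lead_coeff h = 1" "0 < degree h"
      "degree h < degree (\<phi>s ! Suc i)" for i h
  proof -
    have le: "degree (\<phi>s ! Suc i) \<le> degree F"
      using nth_degree_mono[of \<phi>s "Suc i" "length \<phi>s - 1"] step i ne last
      by (simp add: last_conv_nth)
    have less: "degree (\<phi>s ! i) < degree F"
      using le step[OF i] by linarith
    have pos: "0 < degree (\<phi>s ! i)"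
      using nth_degree_mono[of \<phi>s 0 i] step i ne hd by (simp add: hd_conv_nth)
    have i_mem: "\<phi>s ! i \<in> int_polys v" "lead_coeff (\<phi>s ! i) = 1"
      and Suc_mem: "\<phi>s ! Suc i \<in> int_polys v" "lead_coeff (\<phi>s ! Suc i) = 1"
      using mem[of "\<phi>s ! i"] mem[of "\<phi>s ! Suc i"] i by auto
    have "slope w (\<phi>s ! i) (\<theta> F) < slope w (\<phi>s ! Suc i) (\<theta> F)"
    proof (cases "degree (\<phi>s ! Suc i) < degree F")
      case True
      then show ?thesis
        using slopes[OF i h] slope_eq[OF i_mem less] slope_eq[OF Suc_mem] by simp
    next
      case False
      then have degree: "degree (\<phi>s ! Suc i) = degree F"
        using le by simp
      from val_transfer_same_degree[OF F H Suc_mem degree] show ?thesis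
      proof
        assume "val (\<phi>s ! Suc i) (\<theta> F) = val (\<phi>s ! Suc i) (\<theta> H)"
        then show ?thesis
          using slopes[OF i h] slope_eq[OF i_mem less] by (simp add: slope_def)
      next
        \<comment> \<open>By the Okutsu bound the preceding slope is at most
          \<open>bound F / degree F\<close>, which lies below the slope of the last member.\<close>
        assume *: "bound F < val (\<phi>s ! Suc i) (\<theta> F)"
        have "ereal (real (degree F)) * val (\<phi>s ! i) (\<theta> F) \<le>
            ereal (real (degree (\<phi>s ! i))) * bound F"
          using i_mem less by (intro val_le_okutsu_bound)
        then show ?thesis
          using * pos less unfolding slope_def degree
          by (cases "val (\<phi>s ! i) (\<theta> F)"; cases "bound F"; cases "val (\<phi>s ! Suc i) (\<theta> F)")
            (auto simp: field_simps intro: le_less_trans mult_strict_right_mono)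
      qed
    qed
    moreover have "slope w h (\<theta> F) \<le> slope w (\<phi>s ! i) (\<theta> F)"
      using slopes[OF i h] slope_eq[OF i_mem less] slope_eq[OF h(1,2)] h(4) le by simp
    ultimately show ?thesis
      by blast
  qed
  then show ?thesis
    unfolding okutsu_frame_def using ne mem hd last step by blast
qed

text \<open>If the value of \<open>\<phi>\<close> differs between \<open>\<theta> P\<close> and
  \<open>\<theta> HP\<close>, then \<open>\<phi>\<close> is irreducible and imitates
  \<open>P\<close>. If it differs only between \<open>\<theta> Q\<close> and
  \<open>\<theta> HQ\<close>, then \<open>\<phi>\<close> would be too large at
  \<open>\<theta> HQ\<close> for the assumed inequality.\<close>

lemma om_condition_transfer:
  assumes P: "P \<in> factors_f" "HP \<in> monic_irreducibles v" "matched P HP" "degree HP = degree P"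
    and Q: "Q \<in> factors_f" "HQ \<in> monic_irreducibles v" "matched Q HQ" "degree HQ = degree Q"
    and "P \<noteq> Q"
    and \<phi>: "\<phi> \<in> int_polys v" "lead_coeff \<phi> = 1" "degree \<phi> = degree P"
    and less: "val \<phi> (\<theta> HQ) < val \<phi> (\<theta> HP)"
  shows "val \<phi> (\<theta> Q) < val \<phi> (\<theta> P)"
  using P \<phi>(1,2)
proof (cases rule: val_transfer)
  case (diff z \<psi>)
  have "\<psi> = \<phi>"
    using diff \<phi> by (intro monic_eqI_dvd) (auto simp: monic_irreducibles_monic)
  then have \<phi>_irr: "\<phi> \<in> monic_irreducibles v" "z \<in># rts \<phi>"
    using diff by auto
  have "ereal (real (degree Q)) * val \<phi> (\<theta> Q) = ereal (real (degree P)) * val Q z"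
    using val_reciprocity[OF factor_irreducible[OF Q(1)] \<phi>_irr(1) root[OF factor_irreducible[OF Q(1)]] \<phi>_irr(2)]
      \<phi>(3) by simp
  also have "\<dots> = ereal (real (degree P)) * val Q (\<theta> P)"
    using diff(7)[OF Q(1)] \<open>P \<noteq> Q\<close> by simp
  also have "\<dots> = ereal (real (degree Q)) * val P (\<theta> Q)"
    by (rule val_factor_symmetric[OF P(1) Q(1)])
  finally have "val \<phi> (\<theta> Q) = val P (\<theta> Q)"
    using monic_irreducibles_degree_pos[OF factor_irreducible[OF Q(1)]]
    by (simp add: ereal_mult_cancel_left)
  moreover have "val \<phi> (\<theta> P) = val P z"
    using val_eq_of_irreducible_same_degree[OF P(1) \<phi>_irr \<phi>(3)] .
  moreover have "val P (\<theta> Q) < val P z"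
  proof (rule ccontr)
    assume "\<not> val P (\<theta> Q) < val P z"
    then have "val P z + interaction P \<le> val P (\<theta> Q) + interaction P"
      by (intro add_right_mono) auto
    then show False
      using diff(5) val_other_root_less[OF P(1) Q(1)] \<open>P \<noteq> Q\<close> by auto
  qed
  ultimately show ?thesis
    by simp
next
  case eq
  show ?thesis
    using Q \<phi>(1,2)
  proof (cases rule: val_transfer)
    case eqQ: eq
    then show ?thesis
      using eq less by simp
  next
    case (diff z \<psi>)
    note \<psi>_int = monic_irreducibles_int[OF diff(1)] and \<psi>_monic = monic_irreducibles_monic[OF diff(1)]
    obtain \<chi> where \<chi>: "\<phi> = \<psi> * \<chi>"
      using diff(3) by (elim dvdE)
    then have \<chi>_monic: "lead_coeff \<chi> = 1"
      using \<psi>_monic \<phi>(2) lead_coeff_mult[of \<psi> \<chi>] by simp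
    have \<chi>_int: "\<chi> \<in> int_polys v"
      using \<phi> \<chi>_monic \<chi> by (intro int_polys_of_dvd[of \<chi> \<phi>]) auto
    have degrees: "degree P = degree \<psi> + degree \<chi>" "0 < degree \<psi>"
      using \<phi>(3) \<chi> degree_mult_eq[of \<psi> \<chi>] monic_nonzero[OF \<psi>_monic] monic_nonzero[OF \<chi>_monic]
        monic_irreducibles_degree_pos[OF diff(1)] by auto
    have posQ: "0 < degree Q" and posP: "0 < degree P"
      using P Q factor_irreducible monic_irreducibles_degree_pos by auto
    have z: "0 \<le> w z"
      using diff(2) \<psi>_int \<psi>_monic by (intro rts_nonneg[of \<psi>])
    \<comment> \<open>The factor \<open>\<psi>\<close> near \<open>Q\<close> makes
      \<open>\<phi>\<close> large at \<open>\<theta> HQ\<close>: its degree is at least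
      \<open>degree Q\<close>, so reciprocity carries over the value of \<open>HQ\<close> at
      \<open>z\<close>.\<close>
    have "val HQ z \<le> val \<psi> (\<theta> HQ)"
    proof -
      have "ereal (real (degree Q)) * val HQ z \<le> ereal (real (degree \<psi>)) * val HQ z"
        using diff(4) val_nonneg[OF monic_irreducibles_int[OF Q(2)] z]
        by (intro ereal_mult_right_mono) auto
      also have "\<dots> = ereal (real (degree Q)) * val \<psi> (\<theta> HQ)"
        using val_reciprocity[OF diff(1) Q(2) diff(2) root[OF Q(2)]] Q(4) by simp
      finally show ?thesis
        using posQ by (subst (asm) ereal_mult_le_mult_iff) auto
    qed
    also have "\<dots> \<le> val \<phi> (\<theta> HQ)"
      using val_nonneg[OF \<chi>_int root_nonneg[OF Q(2)]] by (simp add: \<chi> val_mult_poly add_increasing2)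
    finally have large: "ereal s \<le> val \<phi> (\<theta> HQ) + interaction Q"
      using diff(6) by (meson add_right_mono order_trans)
    \<comment> \<open>At \<open>\<theta> P\<close>, in contrast, \<open>\<phi>\<close> is small:
      \<open>\<psi>\<close> is compared with \<open>P\<close> by reciprocity, and
      \<open>\<chi>\<close>, of degree below \<open>degree P\<close>, is controlled by the Okutsu
      bound.\<close>
    have "val \<psi> (\<theta> P) \<le> val P (\<theta> Q)"
    proof -
      have "ereal (real (degree P)) * val \<psi> (\<theta> P) = ereal (real (degree \<psi>)) * val P z"
        using val_reciprocity[OF factor_irreducible[OF P(1)] diff(1) root[OF factor_irreducible[OF P(1)]] diff(2)] .
      also have "\<dots> = ereal (real (degree \<psi>)) * val P (\<theta> Q)"
        using diff(7)[OF P(1) \<open>P \<noteq> Q\<close>] by simp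
      also have "\<dots> \<le> ereal (real (degree P)) * val P (\<theta> Q)"
        using degrees P Q by (intro ereal_mult_right_mono val_factor_root_nonneg factor_irreducible) auto
      finally show ?thesis
        using posP by (subst (asm) ereal_mult_le_mult_iff) auto
    qed
    moreover have "val \<chi> (\<theta> P) \<le> bound P"
    proof -
      have "ereal (real (degree P)) * val \<chi> (\<theta> P) \<le> ereal (real (degree \<chi>)) * bound P"
        using \<chi>_int \<chi>_monic degrees by (intro val_le_okutsu_bound) auto
      also have "\<dots> \<le> ereal (real (degree P)) * bound P"
        using degrees P by (intro ereal_mult_right_mono bound_nonneg factor_irreducible) auto
      finally show ?thesis
        using posP by (subst (asm) ereal_mult_le_mult_iff) auto
    qed
    ultimately have "val \<phi> (\<theta> P) + interaction Q \<le> val P (\<theta> Q) + bound P + interaction Q"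
      unfolding \<chi> val_mult_poly by (intro add_mono) auto
    also have "\<dots> < ereal s"
      using val_other_root_add_bound_less[OF P(1) Q(1)] \<open>P \<noteq> Q\<close> by auto
    also have "\<dots> \<le> val \<phi> (\<theta> HQ) + interaction Q"
      by (rule large)
    finally have "val \<phi> (\<theta> P) < val \<phi> (\<theta> HQ)"
      by (meson add_right_mono not_le)
    then show ?thesis
      using less eq by simp
  qed
qed

lemma om_factorisation_transfer:
  assumes "om_factorisation v w \<theta> g I \<Phi>"
  shows "om_factorisation v w \<theta> f I \<Phi>"
proof -
  obtain H where bij: "bij_betw H I factors_g"
    and frames: "\<And>i. i \<in> I \<Longrightarrow> okutsu_frame v w (H i) (\<theta> (H i)) (\<Phi> i)"
    and sep: "\<And>i k. i \<in> I \<Longrightarrow> k \<in> I \<Longrightarrow> i \<noteq> k \<Longrightarrow>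
        val (last (\<Phi> i)) (\<theta> (H k)) < val (last (\<Phi> i)) (\<theta> (H i))"
    using assms unfolding om_factorisation_def by blast
  obtain m where m: "bij_betw m factors_f factors_g" "\<And>F. F \<in> factors_f \<Longrightarrow> matched F (m F)"
    "\<And>F. F \<in> factors_f \<Longrightarrow> degree (m F) = degree F"
    by (rule matching) (rule that)
  define F where "F = inv_into factors_f m \<circ> H"
  have F_bij: "bij_betw F I factors_f"
    unfolding F_def using bij bij_betw_inv_into[OF m(1)] by (rule bij_betw_trans)
  have F: "F i \<in> factors_f" and mF: "m (F i) = H i" if "i \<in> I" for i
    using that F_bij bij bij_betw_inv_into_right[OF m(1)] by (auto simp: F_def bij_betw_def)
  have H: "H i \<in> monic_irreducibles v" "matched (F i) (H i)" "degree (H i) = degree (F i)"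
    if "i \<in> I" for i
    using that bij m(2,3)[OF F[OF that]] mF[OF that] G.factor_irreducible
    by (auto simp: bij_betw_def)
  have "okutsu_frame v w (F i) (\<theta> (F i)) (\<Phi> i)" if "i \<in> I" for i
    using okutsu_frame_transfer[OF F[OF that] H[OF that] frames[OF that]] .
  moreover have "val (last (\<Phi> i)) (\<theta> (F k)) < val (last (\<Phi> i)) (\<theta> (F i))"
    if ik: "i \<in> I" "k \<in> I" "i \<noteq> k" for i k
  proof (rule om_condition_transfer[OF F[OF ik(1)] H[OF ik(1)] F[OF ik(2)] H[OF ik(2)]])
    show "F i \<noteq> F k"
      using ik F_bij by (auto simp: bij_betw_def inj_on_def)
    show "last (\<Phi> i) \<in> int_polys v" "lead_coeff (last (\<Phi> i)) = 1"
      "degree (last (\<Phi> i)) = degree (F i)"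
      using frames[OF ik(1)] H(3)[OF ik(1)] unfolding okutsu_frame_def
      by (metis last_in_set)+
    show "val (last (\<Phi> i)) (\<theta> (H k)) < val (last (\<Phi> i)) (\<theta> (H i))"
      using sep[OF ik] .
  qed
  ultimately show ?thesis
    unfolding om_factorisation_def using F_bij by blast
qed

end

section \<open>From the congruence modulo \<open>p ^ \<sigma>\<close> to the theorem\<close>

lemma padic_order_self:
  fixes p :: "'a::idom"
  assumes "prime_elem p"
  shows "1 \<le> padic_order p p"
proof -
  have p: "p \<noteq> 0" "\<not> p dvd 1"
    using assms by (auto simp: prime_elem_def)
  \<comment> \<open>The exponents are bounded because \<open>p ^ 2 dvd p\<close> would make
    \<open>p\<close> a unit; hence \<open>Max\<close> is a genuine maximum.\<close>
  have "{n. p ^ n dvd p} \<subseteq> {..1}"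
  proof clarsimp
    fix n assume dvd: "p ^ n dvd p"
    show "n \<le> Suc 0"
    proof (rule ccontr)
      assume "\<not> n \<le> Suc 0"
      then have "p ^ 2 dvd p ^ n"
        by (intro le_imp_power_dvd) simp
      then have "p * p dvd p * 1"
        using dvd_trans[OF _ dvd] by (simp add: power2_eq_square)
      then show False
        using p by (simp only: dvd_mult_cancel_left) simp
    qed
  qed
  then have "finite {n. p ^ n dvd p}"
    by (rule finite_subset) simp
  then have "1 \<le> Max {n. p ^ n dvd p}"
    by (intro Max_ge) auto
  then show ?thesis
    using p by (simp add: padic_order_def)
qed

theorem theorem2:
  fixes p :: "'a::idom"
    and j :: "'a fract \<Rightarrow> 'k::field"
    and v :: "'k \<Rightarrow> ereal"
    and w :: "'k alg_closure \<Rightarrow> ereal"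
    and \<theta> :: "'k poly \<Rightarrow> 'k alg_closure"
    and f g :: "'k poly"
    and d \<sigma> :: nat
  assumes "principal_domain (ring_of_type_algebra :: 'a ring)"
    and "prime_elem p"
    and "padic_completion p j v"
    and "is_valuation w" and "\<forall>x. w (to_ac x) = v x"
    and "\<forall>F\<in>monic_irreducibles v. poly (map_poly to_ac F) (\<theta> F) = 0"
    and "f \<in> int_polys v" "lead_coeff f = 1" "degree f = d" "separable_poly f"
    and "g \<in> int_polys v" "lead_coeff g = 1" "degree g = d" "separable_poly g"
    and "\<exists>h\<in>int_polys v. g - f = smult (j (Fract p 1) ^ \<sigma>) h"
  shows "(ereal (real \<sigma>) > 2 * delta_star v w \<theta> f / ereal (real d) \<longrightarrow>
            (ring_irreducible\<^bsub>int_poly_ring v\<^esub> g \<longleftrightarrow> ring_irreducible\<^bsub>int_poly_ring v\<^esub> f)) \<and>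
         (ereal (real \<sigma>) > delta_star v w \<theta> f \<longrightarrow>
            (\<forall>(I :: 'i set) \<Phi>. om_factorisation v w \<theta> g I \<Phi> \<longrightarrow> om_factorisation v w \<theta> f I \<Phi>))"
proof -
  interpret complete_valuation v w
    using assms(3-5) unfolding padic_completion_def by unfold_locales auto
  interpret separable_factorisation v w \<theta> f
    using assms(6-8,10) by unfold_locales (auto simp: in_rts_iff monic_irreducibles_nonzero)
  have "1 \<le> v (j (Fract p 1))"
    using assms(2,3) padic_order_self by (simp add: padic_completion_def)
  then have "ereal (real \<sigma>) * 1 \<le> v (j (Fract p 1) ^ \<sigma>)"
    unfolding base.val_power by (intro ereal_mult_left_mono) auto
  moreover obtain h where h: "h \<in> int_polys v" "g - f = smult (j (Fract p 1) ^ \<sigma>) h"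
    using assms(15) by blast
  ultimately have cong: "ereal (real \<sigma>) \<le> v (coeff (g - f) i)" for i
    unfolding h(2) coeff_smult base.val_mult by (intro add_increasing2) (auto simp: int_polys_def)
  have MI: "ring_irreducible\<^bsub>int_poly_ring v\<^esub> f \<longleftrightarrow> f \<in> monic_irreducibles v"
    "ring_irreducible\<^bsub>int_poly_ring v\<^esub> g \<longleftrightarrow> g \<in> monic_irreducibles v"
    using assms by (auto simp: monic_irreducibles_def)
  have "g \<in> monic_irreducibles v \<longleftrightarrow> f \<in> monic_irreducibles v"
    if less: "ereal (real \<sigma>) > 2 * delta_star v w \<theta> f / ereal (real d)"
  proof -
    \<comment> \<open>For \<open>d = 0\<close> the quotient is degenerate, but then neither
      polynomial is irreducible, since monic irreducibles have positive degree.\<close>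
    have "2 * delta_star v w \<theta> f < ereal (real d) * ereal (real \<sigma>)" if "d > 0"
      using less that by (cases "2 * delta_star v w \<theta> f") (auto simp: field_simps)
    then show ?thesis
      using irreducible_close[of g "real \<sigma>"] irreducible_of_irreducible_close[of g "real \<sigma>"] cong assms(9,11-13)
        monic_irreducibles_degree_pos[of f] monic_irreducibles_degree_pos[of g] by auto
  qed
  moreover have "om_factorisation v w \<theta> f I \<Phi>"
    if "ereal (real \<sigma>) > delta_star v w \<theta> f" "om_factorisation v w \<theta> g I \<Phi>" for I :: "'i set" and \<Phi>
  proof -
    interpret close_factorisation v w \<theta> f g "real \<sigma>"
      using assms that(1) cong by unfold_locales auto
    show ?thesis
      using that(2) by (rule om_factorisation_transfer)
  qed
  ultimately show ?thesis
    unfolding MI by blast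
qed

end
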